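(* Let $\mathfrak X$ be a Banach space, $p\in(0,\infty)$, and $V\in\mathscr A_p(\mathbb R^n;\mathscr L(\mathfrak X))$. Then there are $\varepsilon,\eta>0$ and a constant $C<\infty$ such that $$\rho^{V}_{p+\varepsilon,Q}(\mathfrak e)\le C\,\rho^{V}_{p,Q}(\mathfrak e)\qquad\text{and}\qquad \rho^{V^{-*}}_{p'+\eta,Q}(\mathfrak e^* )\le C\,\rho^{V^{-*}}_{p',Q}(\mathfrak e^* )$$ for all cubes $Q\subset\mathbb R^n$ and all $\mathfrak e\in\mathfrak X$ and $\mathfrak e^*\in\mathfrak X^*$.
   Context: Measurability. $f:\mathbb R^n\to\mathfrak X$ is strongly measurable if it is a pointwise limit of simple functions (finite sums $\sum_i\mathfrak e_i\mathbf 1_{A_i}$, $A_i$ measurable). $L^p(\mathbb R^n;\mathfrak X)$ consists of the strongly measurable $f$ with $\|f(\cdot)\|_{\mathfrak X}\in L^p$. Cubes have sides parallel to the axes. Weights. $V:\mathbb R^n\to\mathscr L(\mathfrak X)$ (bounded linear operators on $\mathfrak X$) is a weight if $V(\cdot)\mathfrak e$ is strongly measurable for every $\mathfrak e\in\mathfrak X$, $V(x)$ is invertible for a.e. $x$, and $V(\cdot)^{-1}\mathfrak e$ is strongly measurable for every $\mathfrak e\in\mathfrak X$. It is a $p$-weight ($p\in(0,\infty]$) if moreover $\mathbf 1_QV(\cdot)\mathfrak e\in L^p(\mathbb R^n;\mathfrak X)$ for all cubes $Q$ and all $\mathfrak e$. $V^{-*}(x):=(V(x)^{-1})^*\in\mathscr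 L(\mathfrak X^* )$; the same notions apply to $V^{-*}$ with $\mathfrak X^*$ in place of $\mathfrak X$. Quasi-norms. $\rho^V_{p,Q}(\mathfrak e):=\big(\frac1{|Q|}\int_Q\|V(x)\mathfrak e\|_{\mathfrak X}^p\,dx\big)^{1/p}$ (essential supremum over $Q$ if $p=\infty$), and similarly $\rho^{V^{-*}}_{p,Q}(\mathfrak e^* )$ for $\mathfrak e^*\in\mathfrak X^*$. The dual norm of a quasi-norm $\rho$ on $\mathfrak X$ is $\rho^*(\mathfrak e^* ):=\sup_{\mathfrak e\in\mathfrak X\setminus\{0\}}|\langle\mathfrak e^*,\mathfrak e\rangle|/\rho(\mathfrak e)$. Conjugate exponent: $p'=p/(p-1)$ if $p\in(1,\infty)$, and $p'=\infty$ if $p\in(0,1]$; $\infty+\eta=\infty$ (so for $p\le1$ the second inequality is trivial). $\mathscr A_p$ condition. For $p\in(0,\infty)$, $V\in\mathscr A_p(\mathbb R^n;\mathscr L(\mathfrak X))$ means that $V$ is a $p$-weight and there is a finite $C$ such that for all cubes $Q$: (i) if $p\in(1,\infty)$: also $V^{-*}$ is a $p'$-weight and $\rho^{V^{-*}}_{p',Q}(\mathfrak e^* )\le C(\rho^V_{p,Q})^*(\mathfrak e^* )$ for all $\mathfrak e^*\in\mathfrak X^*$; (ii) if $p\in(0,1]$: $\operatorname{ess\,sup}_{y\in Q}\rho^V_{p,Q}(V(y)^{-1}\mathfrak e)\le C\|\mathfrak e\|$ for all $\mathfrak e\in\mathfrak X$. *)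

theory Defs
  imports "HOL-Analysis.Analysis" "HOL-Probability.Essential_Supremum"
begin

text \<open>Banach spaces are real. A complex Banach space is covered by regarding it as a real one:
  taking real parts is an isometry of the complex onto the real dual that respects adjoints and
  dual norms.\<close>

section \<open>Bounded operators\<close>

definition blinfun_is_inverse ::
    "('x::real_normed_vector \<Rightarrow>\<^sub>L 'x) \<Rightarrow> ('x \<Rightarrow>\<^sub>L 'x) \<Rightarrow> bool" where
  "blinfun_is_inverse T S \<longleftrightarrow> T o\<^sub>L S = id_blinfun \<and> S o\<^sub>L T = id_blinfun"

definition blinfun_invertible :: "('x::real_normed_vector \<Rightarrow>\<^sub>L 'x) \<Rightarrow> bool" where
  "blinfun_invertible T \<longleftrightarrow> (\<exists>S. blinfun_is_inverse T S)"

text \<open>A weight is invertible only almost everywhere; the inverse is set to \<open>0\<close> at the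
  remaining points.\<close>

definition blinfun_inv :: "('x::real_normed_vector \<Rightarrow>\<^sub>L 'x) \<Rightarrow> ('x \<Rightarrow>\<^sub>L 'x)" where
  "blinfun_inv T = (if blinfun_invertible T then (THE S. blinfun_is_inverse T S) else 0)"

lemma blinfun_inv_eq:
  assumes "blinfun_is_inverse T S"
  shows "blinfun_inv T = S"
proof -
  have "R = S" if "blinfun_is_inverse T R" for R
  proof (rule blinfun_eqI)
    fix x
    have "R (T (S x)) = (R o\<^sub>L T) (S x)" "T (S x) = (T o\<^sub>L S) x"
      by (simp_all only: blinfun_apply_blinfun_compose)
    then have "R (T (S x)) = S x" "T (S x) = x"
      using that assms
      by (simp_all only: blinfun_is_inverse_def blinfun_apply_id_blinfun)
    then show "R x = S x" by simp
  qed
  with assms have "(THE S. blinfun_is_inverse T S) = S"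
    by (rule the_equality)
  moreover have "blinfun_invertible T"
    using assms unfolding blinfun_invertible_def by (rule exI)
  ultimately show ?thesis
    by (simp only: blinfun_inv_def if_True)
qed

type_synonym 'x dual = "'x \<Rightarrow>\<^sub>L real"

definition blinfun_adjoint ::
    "('x::real_normed_vector \<Rightarrow>\<^sub>L 'x) \<Rightarrow> ('x dual \<Rightarrow>\<^sub>L 'x dual)" where
  "blinfun_adjoint T = Blinfun (\<lambda>f. f o\<^sub>L T)"

lemma blinfun_adjoint_apply: "blinfun_adjoint T f x = f (T x)"
proof -
  have "bounded_linear (\<lambda>f::'a dual. f o\<^sub>L T)"
    by (rule bounded_bilinear.bounded_linear_left[OF bounded_bilinear_blinfun_compose])
  then show ?thesis
    by (simp only: blinfun_adjoint_def bounded_linear_Blinfun_apply blinfun_apply_blinfun_compose)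
qed

definition inv_adjoint ::
    "('a \<Rightarrow> ('x::real_normed_vector \<Rightarrow>\<^sub>L 'x)) \<Rightarrow> 'a \<Rightarrow> ('x dual \<Rightarrow>\<^sub>L 'x dual)" where
  "inv_adjoint V = (\<lambda>x. blinfun_adjoint (blinfun_inv (V x)))"

section \<open>Measurability and Lebesgue spaces\<close>

definition strongly_measurable :: "(real ^ 'n \<Rightarrow> 'x::real_normed_vector) \<Rightarrow> bool" where
  "strongly_measurable f \<longleftrightarrow>
     (\<exists>s. (\<forall>k::nat. simple_function lebesgue (s k)) \<and> (\<forall>x. (\<lambda>k. s k x) \<longlonglongrightarrow> f x))"

definition ennreal_powr :: "ennreal \<Rightarrow> real \<Rightarrow> ennreal" where
  \<comment> \<open>used for positive exponents only\<close>
  "ennreal_powr t r = (if t = \<infinity> then \<infinity> else ennreal (enn2real t powr r))"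

definition in_Lp :: "ennreal \<Rightarrow> (real ^ 'n \<Rightarrow> 'x::real_normed_vector) \<Rightarrow> bool" where
  "in_Lp p f \<longleftrightarrow> strongly_measurable f \<and>
     (if p = \<infinity> then esssup lebesgue (\<lambda>x. ennreal (norm (f x))) < \<infinity>
      else (\<integral>\<^sup>+ x. ennreal (norm (f x) powr enn2real p) \<partial>lebesgue) < \<infinity>)"

text \<open>Whether cubes are closed, open or half-open is immaterial below, since their boundaries are
  Lebesgue null sets.\<close>

definition cubes :: "(real ^ 'n) set set" where
  "cubes = {cbox a (a + (\<chi> i. l)) | a l. 0 < l}"

section \<open>Weights\<close>

definition weight :: "(real ^ 'n \<Rightarrow> ('x::real_normed_vector \<Rightarrow>\<^sub>L 'x)) \<Rightarrow> bool" where
  "weight V \<longleftrightarrow>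
     (\<forall>e. strongly_measurable (\<lambda>x. V x e)) \<and>
     (AE x in lebesgue. blinfun_invertible (V x)) \<and>
     (\<forall>e. strongly_measurable (\<lambda>x. blinfun_inv (V x) e))"

definition p_weight ::
    "ennreal \<Rightarrow> (real ^ 'n \<Rightarrow> ('x::real_normed_vector \<Rightarrow>\<^sub>L 'x)) \<Rightarrow> bool" where
  "p_weight p V \<longleftrightarrow> weight V \<and> (\<forall>Q\<in>cubes. \<forall>e. in_Lp p (\<lambda>x. indicat_real Q x *\<^sub>R V x e))"

definition rho ::
    "ennreal \<Rightarrow> (real ^ 'n \<Rightarrow> ('x::real_normed_vector \<Rightarrow>\<^sub>L 'x)) \<Rightarrow> (real ^ 'n) set \<Rightarrow> 'x \<Rightarrow> ennreal"
  where
  "rho p V Q e =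
     (if p = \<infinity> then esssup (restrict_space lebesgue Q) (\<lambda>x. ennreal (norm (V x e)))
      else ennreal_powr
        ((\<integral>\<^sup>+x\<in>Q. ennreal (norm (V x e) powr enn2real p) \<partial>lebesgue) / emeasure lebesgue Q)
        (1 / enn2real p))"

definition dual_norm :: "('x::real_normed_vector \<Rightarrow> ennreal) \<Rightarrow> 'x dual \<Rightarrow> ennreal" where
  "dual_norm \<rho> f = (SUP e\<in>UNIV - {0}. ennreal \<bar>f e\<bar> / \<rho> e)"

definition conj_exponent :: "real \<Rightarrow> ennreal" where
  "conj_exponent p = (if p \<le> 1 then \<infinity> else ennreal (p / (p - 1)))"

definition Ap_weight ::
    "real \<Rightarrow> (real ^ 'n \<Rightarrow> ('x::real_normed_vector \<Rightarrow>\<^sub>L 'x)) \<Rightarrow> bool" where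
  "Ap_weight p V \<longleftrightarrow> p_weight (ennreal p) V \<and>
     (if p > 1 then
        p_weight (conj_exponent p) (inv_adjoint V) \<and>
        (\<exists>C::real. \<forall>Q\<in>cubes. \<forall>f::'x dual.
           rho (conj_exponent p) (inv_adjoint V) Q f
             \<le> ennreal C * dual_norm (rho (ennreal p) V Q) f)
      else
        (\<exists>C::real. \<forall>Q\<in>cubes. \<forall>e.
           esssup (restrict_space lebesgue Q) (\<lambda>y. rho (ennreal p) V Q (blinfun_inv (V y) e))
             \<le> ennreal C * ennreal (norm e)))"

end

theory Submission
  imports Defs
begin

text \<open>
  For fixed \<open>e\<close> the scalar function \<open>w = \<parallel>V(\<cdot>) e\<parallel>\<^sup>p\<close> is shown to be spread out: with a constant
  \<open>\<beta>\<close> independent of \<open>e\<close> and \<open>Q\<close>, the set where \<open>w\<close> is at most \<open>\<beta>\<close> times its average over \<open>Q\<close>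
  fills at most half of \<open>Q\<close>. For \<open>p > 1\<close>, choose by Hahn--Banach a functional \<open>f\<close> of dual norm at
  most one with \<open>f e = \<rho>(e)\<close>; since \<open>\<rho>(e) = f e \<le> \<parallel>V\<^sup>-\<^sup>* f\<parallel> \<parallel>V e\<parallel>\<close> almost everywhere, \<open>V e\<close> is small only
  where \<open>V\<^sup>-\<^sup>* f\<close> is large, and Chebyshev's inequality applies. The dual weight is handled with the
  roles exchanged, the definition of the dual norm replacing Hahn--Banach. For \<open>p \<le> 1\<close> one even has
  \<open>\<rho>(e) \<le> C \<parallel>V(y) e\<parallel>\<close> for almost every \<open>y\<close>.

  Spread functions satisfy a reverse Hoelder inequality. A Calderon--Zygmund stopping argument bounds
  the \<open>w\<close>-mass of \<open>{w > t}\<close> by \<open>c t\<close> times the measure of \<open>{w > \<beta> t}\<close>; absorbing the part above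
  a large multiple of \<open>t\<close> shows that the mass of the level sets decays geometrically, and summing
  over levels gives the bound.
\<close>

section \<open>Cubes and dyadic cells\<close>

text \<open>Half-open, so that dyadic subdivision partitions it exactly; it differs from the closed
  cube with the same data only by a null set.\<close>

definition hcube :: "real ^ 'n \<Rightarrow> real \<Rightarrow> (real ^ 'n) set" where
  "hcube a l = {y. \<forall>i. a $ i \<le> y $ i \<and> y $ i < a $ i + l}"

lemma hcube_subset_cbox: "hcube a l \<subseteq> cbox a (a + (\<chi> i. l))"
  by (auto simp: hcube_def mem_box_cart less_imp_le)

lemma box_subset_hcube: "box a (a + (\<chi> i. l)) \<subseteq> hcube a l"
  by (auto simp: hcube_def mem_box_cart less_imp_le)

lemma hcube_borel [measurable]: "hcube a l \<in> sets borel"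
  unfolding hcube_def by measurable

lemma hcube_lebesgue [measurable]: "hcube a l \<in> sets lebesgue"
  using hcube_borel[of a l] by simp

lemma AE_hcube_iff_cbox: "AE x in lebesgue. x \<in> hcube a l \<longleftrightarrow> x \<in> cbox a (a + (\<chi> i. l))"
proof -
  have "negligible (cbox a (a + (\<chi> i. l)) - box a (a + (\<chi> i. l)))"
    by (rule negligible_frontier_interval)
  then have "AE x in lebesgue. x \<notin> cbox a (a + (\<chi> i. l)) - box a (a + (\<chi> i. l))"
    by (intro AE_not_in) (simp add: negligible_iff_null_sets)
  then show ?thesis
    by eventually_elim (use hcube_subset_cbox[of a l] box_subset_hcube[of a l] in blast)
qed

section \<open>Volume of cubes\<close>

lemma emeasure_cube:
  fixes a :: "real ^ 'n"
  assumes "0 < l"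
  shows "emeasure lebesgue (cbox a (a + (\<chi> i. l))) = ennreal (l ^ CARD('n))"
proof -
  have "cbox a (a + (\<chi> i. l)) \<noteq> {}"
    using assms by (simp add: interval_ne_empty_cart)
  then have "measure lebesgue (cbox a (a + (\<chi> i. l))) = l ^ CARD('n)"
    by (simp add: content_cbox_cart)
  then show ?thesis
    by (simp add: emeasure_eq_measure2)
qed

lemma emeasure_hcube:
  fixes a :: "real ^ 'n"
  assumes "0 < l"
  shows "emeasure lebesgue (hcube a l) = ennreal (l ^ CARD('n))"
proof -
  have "emeasure lebesgue (hcube a l) = emeasure lebesgue (cbox a (a + (\<chi> i. l)))"
    by (rule emeasure_eq_AE[OF AE_hcube_iff_cbox]) auto
  also note emeasure_cube[OF assms]
  finally show ?thesis .
qed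

lemma measure_hcube:
  fixes a :: "real ^ 'n"
  assumes "0 < l"
  shows "measure lebesgue (hcube a l) = l ^ CARD('n)"
  using emeasure_hcube[OF assms, of a] assms by (simp add: measure_def)

text \<open>For positive \<open>l\<close>, the half-open cell of side \<open>l / 2 ^ k\<close> that
  contains \<open>x\<close>, in the dyadic grid of the whole space anchored at \<open>a\<close>.
  Being classes of points with equal floors, two cells of one generation coincide or are
  disjoint.\<close>

definition dcell :: "real ^ 'n \<Rightarrow> real \<Rightarrow> nat \<Rightarrow> real ^ 'n \<Rightarrow> (real ^ 'n) set" where
  "dcell a l k x =
     {y. \<forall>i. \<lfloor>2 ^ k * ((y $ i - a $ i) / l)\<rfloor> = \<lfloor>2 ^ k * ((x $ i - a $ i) / l)\<rfloor>}"

lemma dcell_eq_hcube: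
  assumes "0 < l"
  shows "dcell a l k x =
    hcube (\<chi> i. a $ i + l / 2 ^ k * of_int \<lfloor>2 ^ k * ((x $ i - a $ i) / l)\<rfloor>) (l / 2 ^ k)"
proof -
  have "\<lfloor>2 ^ k * ((u - c) / l)\<rfloor> = m \<longleftrightarrow>
      c + l / 2 ^ k * of_int m \<le> u \<and> u < c + l / 2 ^ k * of_int m + l / 2 ^ k"
    for u c :: real and m :: int
    using assms by (auto simp: floor_eq_iff field_simps)
  then show ?thesis
    by (simp add: dcell_def hcube_def)
qed

lemma dcell_self: "x \<in> dcell a l k x"
  by (simp add: dcell_def)

lemma dcell_eq_iff: "y \<in> dcell a l k x \<Longrightarrow> dcell a l k y = dcell a l k x"
  by (auto simp: dcell_def)

lemma dcell_0:
  assumes "0 < l" "x \<in> hcube a l"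
  shows "dcell a l 0 x = hcube a l"
proof -
  have "\<lfloor>(x $ i - a $ i) / l\<rfloor> = 0" for i
    using assms by (auto simp: hcube_def floor_eq_iff field_simps)
  then show ?thesis
    using assms by (simp add: dcell_eq_hcube)
qed

text \<open>The floor at one generation is the integer half of the floor at the next one, so points
  that share a cell also share its parent.\<close>

lemma dcell_Suc: "dcell a l (Suc k) x \<subseteq> dcell a l k x"
proof -
  have "\<lfloor>2 ^ k * t\<rfloor> = \<lfloor>2 ^ Suc k * t\<rfloor> div 2" for t :: real
    using floor_divide_real_eq_div[of 2 "2 ^ Suc k * t"] by (simp add: mult_ac)
  note half = this
  show ?thesis
    unfolding dcell_def
  proof (intro subsetI CollectI allI)
    fix y i
    assume "y \<in> {y. \<forall>i. \<lfloor>2 ^ Suc k * ((y $ i - a $ i) / l)\<rfloor> = \<lfloor>2 ^ Suc k * ((x $ i - a $ i) / l)\<rfloor>}"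
    then show "\<lfloor>2 ^ k * ((y $ i - a $ i) / l)\<rfloor> = \<lfloor>2 ^ k * ((x $ i - a $ i) / l)\<rfloor>"
      unfolding half[of "(y $ i - a $ i) / l"] half[of "(x $ i - a $ i) / l"] by simp
  qed
qed

lemma dcell_mono: "j \<le> k \<Longrightarrow> dcell a l k x \<subseteq> dcell a l j x"
  using dcell_Suc by (rule lift_Suc_antimono_le)

lemma dcell_lebesgue [measurable]: "0 < l \<Longrightarrow> dcell a l k x \<in> sets lebesgue"
  by (simp add: dcell_eq_hcube)

text \<open>A cell is determined by its generation and an integer vector of floors.\<close>

lemma countable_dcells: "countable {dcell a l k x | k x. True}"
proof -
  have "{dcell a l k x | k x. True} \<subseteq>
      (\<lambda>(k, m). {y. \<forall>i. \<lfloor>2 ^ k * ((y $ i - a $ i) / l)\<rfloor> = m i}) ` (UNIV :: (nat \<times> ('a \<Rightarrow> int)) set)"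
    unfolding dcell_def by (force intro!: image_eqI)
  then show ?thesis
    by (rule countable_subset) simp
qed

lemma dcell_subset_open:
  assumes "0 < l" "open U" "x \<in> U"
  obtains k where "dcell a l k x \<subseteq> U"
proof -
  obtain r where r: "r > 0" "ball x r \<subseteq> U"
    using assms open_contains_ball by blast
  \<comment> \<open>The number of coordinates pays for bounding the Euclidean norm by the sum of the
    coordinates; the 2 makes the final estimate strict.\<close>
  define r' where "r' = r / (2 * real CARD('a))"
  have r': "r' > 0" using r by (simp add: r'_def)
  obtain k :: nat where k: "l / r' < 2 ^ k"
    using real_arch_pow[of 2 "l / r'"] by auto
  have "dist x y < r" if "y \<in> dcell a l k x" for y
  proof -
    have "\<bar>x $ i - y $ i\<bar> \<le> r'" for i
    proof -
      have "\<lfloor>2 ^ k * ((y $ i - a $ i) / l)\<rfloor> = \<lfloor>2 ^ k * ((x $ i - a $ i) / l)\<rfloor>"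
        using that by (simp add: dcell_def)
      then have "\<bar>2 ^ k * ((y $ i - a $ i) / l) - 2 ^ k * ((x $ i - a $ i) / l)\<bar> < 1"
        by linarith
      then have "2 ^ k * \<bar>y $ i - x $ i\<bar> < l"
        using assms(1) by (simp add: field_simps abs_if split: if_splits)
      moreover have "l < 2 ^ k * r'"
        using k r' by (simp add: field_simps)
      ultimately have "2 ^ k * \<bar>y $ i - x $ i\<bar> < 2 ^ k * r'" by linarith
      then have "\<bar>y $ i - x $ i\<bar> < r'" by simp
      then show ?thesis by simp
    qed
    then have "norm (x - y) \<le> (\<Sum>i\<in>(UNIV::'a set). r')"
      by (intro order_trans[OF norm_le_l1_cart] sum_mono) simp
    also have "\<dots> < r"
      using r by (simp add: r'_def)
    finally show ?thesis by (simp add: dist_norm)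
  qed
  then have "dcell a l k x \<subseteq> U"
    using r(2) by (auto simp: subset_iff)
  then show thesis by (rule that)
qed

text \<open>The cells with \<open>P\<close> none of whose ancestors has \<open>P\<close> are
  countably many, pairwise disjoint, and have the set in question as their union. An inequality
  between two measures on each of these stopped cells therefore adds up over the union.\<close>

lemma stopping_le:
  fixes a :: "real ^ 'n"
  assumes l: "0 < l"
    and M: "sets M = sets lebesgue" and N: "sets N = sets lebesgue"
    and le: "\<And>k x. P (dcell a l k x) \<Longrightarrow> (\<And>j. j < k \<Longrightarrow> \<not> P (dcell a l j x)) \<Longrightarrow>
      emeasure M (dcell a l k x) \<le> emeasure N (dcell a l k x)"
  shows "{x. \<exists>k. P (dcell a l k x)} \<in> sets lebesgue"
    and "emeasure M {x. \<exists>k. P (dcell a l k x)} \<le> emeasure N {x. \<exists>k. P (dcell a l k x)}"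
proof -
  define F where "F = {dcell a l k x | k x. P (dcell a l k x) \<and> (\<forall>j<k. \<not> P (dcell a l j x))}"
  have cF: "countable F"
    by (rule countable_subset[OF _ countable_dcells[of a l]]) (auto simp: F_def)
  have un: "{x. \<exists>k. P (dcell a l k x)} = \<Union>F"
  proof (intro set_eqI iffI)
    fix x assume "x \<in> {x. \<exists>k. P (dcell a l k x)}"
    then have ex: "\<exists>k. P (dcell a l k x)" by simp
    define k where "k = (LEAST k. P (dcell a l k x))"
    have "P (dcell a l k x)" unfolding k_def using ex by (rule LeastI_ex)
    moreover have "\<forall>j<k. \<not> P (dcell a l j x)" unfolding k_def by (blast dest: not_less_Least)
    ultimately have "dcell a l k x \<in> F" by (auto simp: F_def)
    then show "x \<in> \<Union>F" using dcell_self by blast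
  next
    fix x assume "x \<in> \<Union>F"
    then obtain k y where "P (dcell a l k y)" "x \<in> dcell a l k y" by (auto simp: F_def)
    then show "x \<in> {x. \<exists>k. P (dcell a l k x)}" using dcell_eq_iff[of x a l k y] by (auto intro!: exI[of _ k])
  qed
  have disj: "disjoint_family_on (\<lambda>R. R) F"
  proof (unfold disjoint_family_on_def, intro ballI impI)
    fix R S assume R: "R \<in> F" and S: "S \<in> F" and ne: "R \<noteq> S"
    obtain k x where kx: "R = dcell a l k x" "P (dcell a l k x)" "\<forall>j<k. \<not> P (dcell a l j x)"
      using R by (auto simp: F_def)
    obtain m y where my: "S = dcell a l m y" "P (dcell a l m y)" "\<forall>j<m. \<not> P (dcell a l j y)"
      using S by (auto simp: F_def)
    show "R \<inter> S = {}"
    proof (rule ccontr)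
      assume "R \<inter> S \<noteq> {}"
      then obtain z where z: "z \<in> dcell a l k x" "z \<in> dcell a l m y" using kx my by auto
      \<comment> \<open>The ancestors of a common point are those of both cells. If the generations
        differed, the cell of the later one would have an ancestor with \<open>P\<close>.\<close>
      have "dcell a l j z = dcell a l j x" if "j \<le> k" for j
        using dcell_mono[OF that] z dcell_eq_iff by blast
      moreover have "dcell a l j z = dcell a l j y" if "j \<le> m" for j
        using dcell_mono[OF that] z dcell_eq_iff by blast
      ultimately have "k = m \<and> R = S"
        using kx my by (metis linorder_neqE_nat order_refl less_imp_le)
      then show False using ne by simp
    qed
  qed
  have sF: "R \<in> sets lebesgue" if "R \<in> F" for R
    using that l by (auto simp: F_def)
  show "{x. \<exists>k. P (dcell a l k x)} \<in> sets lebesgue"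
    unfolding un using cF sF by (intro sets.countable_Union) auto
  have "emeasure M (\<Union>F) = (\<integral>\<^sup>+R. emeasure M R \<partial>count_space F)"
    using emeasure_UN_countable[OF _ cF disj, of M] sF M by simp
  also have "\<dots> \<le> (\<integral>\<^sup>+R. emeasure N R \<partial>count_space F)"
    by (intro nn_integral_mono) (auto simp: F_def intro!: le)
  also have "\<dots> = emeasure N (\<Union>F)"
    using emeasure_UN_countable[OF _ cF disj, of N] sF N by simp
  finally show "emeasure M {x. \<exists>k. P (dcell a l k x)} \<le> emeasure N {x. \<exists>k. P (dcell a l k x)}"
    by (simp add: un)
qed

section \<open>Reverse Hoelder inequality for spread functions\<close>

abbreviation weighted :: "(real ^ 'n \<Rightarrow> real) \<Rightarrow> (real ^ 'n) measure" where
  "weighted w \<equiv> density lebesgue (\<lambda>x. ennreal (w x))"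

text \<open>A quantitative Muckenhoupt A-infinity condition, with the average over the cube
  multiplied out by the volume. Finite mass keeps \<open>measure\<close> faithful, since it would
  turn an infinite mass into 0.\<close>

definition spread :: "real \<Rightarrow> (real ^ 'n \<Rightarrow> real) \<Rightarrow> bool" where
  "spread \<beta> w \<longleftrightarrow> w \<in> borel_measurable lebesgue \<and> (\<forall>x. 0 \<le> w x) \<and>
     (\<forall>a l. 0 < l \<longrightarrow> emeasure (weighted w) (hcube a l) < \<infinity> \<and>
        measure lebesgue {x \<in> hcube a l. w x * l ^ CARD('n) \<le> \<beta> * measure (weighted w) (hcube a l)}
          \<le> l ^ CARD('n) / 2)"

text \<open>This takes the place of Lebesgue differentiation. Cells inside an open set barely larger
  than \<open>A\<close> cover \<open>A\<close>, so the \<open>w\<close>-mass of \<open>A\<close> is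
  at most \<open>t\<close> times its volume; as \<open>w\<close> exceeds \<open>t\<close> on
  \<open>A\<close>, the volume must be 0.\<close>

lemma null_above_cell_averages:
  fixes a :: "real ^ 'n"
  assumes l: "0 < l" and w [measurable]: "w \<in> borel_measurable lebesgue" and lam: "0 \<le> t"
  defines "A \<equiv> {x \<in> hcube a l. (\<forall>k. emeasure (weighted w) (dcell a l k x) \<le>
      ennreal t * emeasure lebesgue (dcell a l k x)) \<and> t < w x}"
  shows "A \<in> null_sets lebesgue"
proof -
  define B where "B = {x. \<exists>k. \<not> emeasure (weighted w) (dcell a l k x) \<le>
      ennreal t * emeasure lebesgue (dcell a l k x)}"
  \<comment> \<open>Both measures are taken to be \<open>lebesgue\<close>, which makes the
    comparison trivial; only measurability is wanted.\<close>
  have [measurable]: "B \<in> sets lebesgue"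
    unfolding B_def by (rule stopping_le(1)[OF l refl refl]) simp
  have "A = (hcube a l - B) \<inter> {x \<in> space lebesgue. t < w x}"
    by (auto simp: A_def B_def)
  also have "\<dots> \<in> sets lebesgue" by measurable
  finally have [measurable]: "A \<in> sets lebesgue" .
  have fin: "emeasure lebesgue A < \<infinity>"
  proof -
    have "emeasure lebesgue A \<le> emeasure lebesgue (hcube a l)"
      by (intro emeasure_mono) (auto simp: A_def)
    also have "\<dots> < \<infinity>"
      unfolding emeasure_hcube[OF l] by simp
    finally show ?thesis .
  qed
  have "emeasure (weighted w) A \<le> ennreal t * emeasure lebesgue A"
  proof (rule ennreal_le_epsilon)
    fix e :: real assume e: "0 < e"
    \<comment> \<open>The denominator \<open>t + 1\<close> covers \<open>t = 0\<close> too, and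
      \<open>t * (e / (t + 1)) \<le> e\<close>.\<close>
    have "0 < e / (t + 1)" using e lam by simp
    then obtain U where U: "open U" "A \<subseteq> U" "U - A \<in> lmeasurable"
        "emeasure lebesgue (U - A) < ennreal (e / (t + 1))"
      using sets_lebesgue_outer_open[of A "e / (t + 1)"] by auto
    \<comment> \<open>Keeping the cells inside \<open>U\<close> bounds their total volume by that of
      \<open>U\<close>; every point of \<open>A\<close> has such a cell.\<close>
    define P where "P R \<longleftrightarrow> R \<subseteq> U \<and> emeasure (weighted w) R \<le> ennreal t * emeasure lebesgue R" for R
    define W where "W = {x. \<exists>k. P (dcell a l k x)}"
    have W: "W \<in> sets lebesgue" "emeasure (weighted w) W \<le> emeasure (density lebesgue (\<lambda>x. ennreal t)) W"
      unfolding W_def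
      by (rule stopping_le[OF l, where M = "weighted w" and N = "density lebesgue (\<lambda>x. ennreal t)"];
          use l in \<open>simp add: P_def emeasure_density_const\<close>)+
    have "A \<subseteq> W"
    proof
      fix x assume x: "x \<in> A"
      then obtain k where "dcell a l k x \<subseteq> U"
        using dcell_subset_open[OF l U(1), of x a] U(2) by auto
      then show "x \<in> W" using x by (auto simp: W_def P_def A_def)
    qed
    have "W \<subseteq> U" using dcell_self by (fastforce simp: W_def P_def)
    have Us: "U \<in> sets lebesgue" using U(1) by (simp add: borel_open)
    have "emeasure (weighted w) A \<le> emeasure (weighted w) W"
      using \<open>A \<subseteq> W\<close> W(1) by (intro emeasure_mono) auto
    also have "\<dots> \<le> ennreal t * emeasure lebesgue W"
      using W by (simp add: emeasure_density_const)
    also have "\<dots> \<le> ennreal t * emeasure lebesgue U"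
      using \<open>W \<subseteq> U\<close> Us by (intro mult_left_mono emeasure_mono) auto
    also have "emeasure lebesgue U = emeasure lebesgue A + emeasure lebesgue (U - A)"
      using U Us by (subst plus_emeasure) (auto simp: Un_absorb1)
    also have "ennreal t * \<dots> \<le> ennreal t * (emeasure lebesgue A + ennreal (e / (t + 1)))"
      using U(4) by (intro mult_left_mono add_left_mono) auto
    also have "\<dots> = ennreal t * emeasure lebesgue A + ennreal (t * (e / (t + 1)))"
      using lam e by (subst ennreal_mult) (auto simp: distrib_left)
    also have "\<dots> \<le> ennreal t * emeasure lebesgue A + ennreal e"
      using lam e by (intro add_left_mono ennreal_leI) (simp add: field_simps)
    finally show "emeasure (weighted w) A \<le> ennreal t * emeasure lebesgue A + ennreal e" .
  qed
  \<comment> \<open>On \<open>A\<close> the weight is split into \<open>w x - t\<close> and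
    \<open>t\<close>. The second part has finite integral and cancels against the upper bound, so
    the integral of the positive first part is 0.\<close>
  moreover have "emeasure (weighted w) A =
      (\<integral>\<^sup>+x. ennreal (w x - t) * indicator A x \<partial>lebesgue) + ennreal t * emeasure lebesgue A"
  proof -
    have "emeasure (weighted w) A = (\<integral>\<^sup>+x. ennreal (w x) * indicator A x \<partial>lebesgue)"
      by (simp add: emeasure_density)
    also have "\<dots> = (\<integral>\<^sup>+x. ennreal (w x - t) * indicator A x + ennreal t * indicator A x \<partial>lebesgue)"
      using lam by (intro nn_integral_cong)
        (auto simp: A_def indicator_def simp flip: ennreal_plus)
    also have "\<dots> = (\<integral>\<^sup>+x. ennreal (w x - t) * indicator A x \<partial>lebesgue) + ennreal t * emeasure lebesgue A"
      by (subst nn_integral_add) (auto simp: nn_integral_cmult_indicator)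
    finally show ?thesis .
  qed
  ultimately have "(\<integral>\<^sup>+x. ennreal (w x - t) * indicator A x \<partial>lebesgue) + ennreal t * emeasure lebesgue A
      \<le> 0 + ennreal t * emeasure lebesgue A"
    by simp
  moreover have "ennreal t * emeasure lebesgue A < \<infinity>"
    using fin by (simp add: ennreal_mult_less_top)
  ultimately have "(\<integral>\<^sup>+x. ennreal (w x - t) * indicator A x \<partial>lebesgue) = 0"
    using ennreal_add_left_cancel_le[of "ennreal t * emeasure lebesgue A" _ 0]
    by (simp only: add.commute) (auto simp: less_top)
  then have "AE x in lebesgue. ennreal (w x - t) * indicator A x = 0"
    by (subst (asm) nn_integral_0_iff_AE) auto
  then have "AE x in lebesgue. x \<notin> A"
    by eventually_elim (auto simp: A_def indicator_def ennreal_eq_0_iff)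
  then show ?thesis by (simp add: AE_iff_null_sets)
qed

text \<open>Calderon--Zygmund decomposition at height \<open>t\<close>: cells stop as soon as their
  average exceeds \<open>t\<close>. The parent of a stopped cell still has average at most
  \<open>t\<close>, which bounds the mass of the cell by \<open>2 ^ CARD('n) * t\<close> times its
  volume; spreading places half of that volume in \<open>{w > \<beta> t}\<close>.\<close>

lemma spread_level_bound:
  fixes a :: "real ^ 'n"
  assumes sp: "spread \<beta> w" and beta: "0 \<le> \<beta>" and l: "0 < l" and lam: "0 \<le> t"
    and avg: "measure (weighted w) (hcube a l) \<le> t * l ^ CARD('n)"
  shows "measure (weighted w) {x \<in> hcube a l. t < w x} \<le>
    2 ^ (CARD('n) + 1) * t * measure lebesgue {x \<in> hcube a l. \<beta> * t < w x}"
proof -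
  let ?n = "CARD('n)" and ?Q = "hcube a l"
  have w [measurable]: "w \<in> borel_measurable lebesgue"
    using sp by (auto simp: spread_def)
  have fin: "emeasure (weighted w) (hcube b r) < \<infinity>" if "0 < r" for b r
    using sp that by (auto simp: spread_def)
  have emW: "emeasure (weighted w) (hcube b r) = ennreal (measure (weighted w) (hcube b r))" if "0 < r" for b r
    using fin[OF that, of b] by (simp add: emeasure_eq_ennreal_measure less_top)
  define P where "P R \<longleftrightarrow> R \<subseteq> ?Q \<and> \<not> emeasure (weighted w) R \<le> ennreal t * emeasure lebesgue R" for R
  define G where "G = {x. \<beta> * t < w x}"
  have [measurable]: "G \<in> sets lebesgue"
  proof -
    have "G = {x \<in> space lebesgue. \<beta> * t < w x}" by (simp add: G_def)
    also have "\<dots> \<in> sets lebesgue" by measurable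
    finally show ?thesis .
  qed
  define c where "c = 2 ^ (?n + 1) * t"
  have c: "0 \<le> c" using lam by (simp add: c_def)
  \<comment> \<open>The right-hand side is written as a measure, so that the two sides can be
    compared cell by cell.\<close>
  define N where "N = density lebesgue (\<lambda>x. ennreal c * indicator G x)"
  have N: "emeasure N A = ennreal c * emeasure lebesgue (A \<inter> G)" if [measurable]: "A \<in> sets lebesgue" for A
  proof -
    have "emeasure N A = (\<integral>\<^sup>+x. ennreal c * indicator (A \<inter> G) x \<partial>lebesgue)"
      unfolding N_def by (subst emeasure_density) (auto intro!: nn_integral_cong simp: indicator_def)
    then show ?thesis by (simp only: nn_integral_cmult_indicator sets.Int that \<open>G \<in> sets lebesgue\<close>)
  qed
  define W where "W = {x. \<exists>k. P (dcell a l k x)}"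
  have W: "W \<in> sets lebesgue" "emeasure (weighted w) W \<le> emeasure N W"
  proof -
    have key: "emeasure (weighted w) (dcell a l k x) \<le> emeasure N (dcell a l k x)"
      if P: "P (dcell a l k x)" and nP: "\<And>j. j < k \<Longrightarrow> \<not> P (dcell a l j x)" for k x
    proof -
      have xQ: "x \<in> ?Q" using P dcell_self by (fastforce simp: P_def)
      \<comment> \<open>By \<open>avg\<close> the whole cube does not stop, so every stopped cell
        has a parent inside the cube.\<close>
      have k0: "k \<noteq> 0"
      proof
        assume "k = 0"
        then have "\<not> emeasure (weighted w) ?Q \<le> ennreal t * emeasure lebesgue ?Q"
          using P dcell_0[OF l xQ] by (simp add: P_def)
        then show False
          using avg lam l emeasure_hcube[OF l, of a] by (simp add: emW flip: ennreal_mult)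
      qed
      then obtain j where j: "k = Suc j" by (cases k) auto
      define r where "r = l / 2 ^ k"
      have r: "r > 0" using l by (simp add: r_def)
      obtain b where b: "dcell a l k x = hcube b r"
        unfolding r_def using dcell_eq_hcube[OF l] by blast
      obtain b' where b': "dcell a l j x = hcube b' (2 * r)"
        using dcell_eq_hcube[OF l, of a j x] by (simp add: r_def j)
      have "hcube b' (2 * r) \<subseteq> ?Q"
        using dcell_mono[of 0 j a l x] dcell_0[OF l xQ] b' by simp
      then have "emeasure (weighted w) (hcube b' (2 * r)) \<le> ennreal t * emeasure lebesgue (hcube b' (2 * r))"
        using nP[of j] j by (simp add: P_def b')
      then have up': "measure (weighted w) (hcube b' (2 * r)) \<le> t * (2 * r) ^ ?n"
        using r lam emeasure_hcube[of "2 * r" b'] by (simp add: emW flip: ennreal_mult)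
      have "emeasure (weighted w) (hcube b r) \<le> emeasure (weighted w) (hcube b' (2 * r))"
        using dcell_Suc[of a l j x] b b' j by (intro emeasure_mono) auto
      then have "measure (weighted w) (hcube b r) \<le> measure (weighted w) (hcube b' (2 * r))"
        using r by (simp add: emW)
      with up' have up: "measure (weighted w) (hcube b r) \<le> t * 2 ^ ?n * r ^ ?n"
        by (simp add: power_mult_distrib)
      have low: "t * r ^ ?n < measure (weighted w) (hcube b r)"
        using P r lam emeasure_hcube[OF r, of b] by (simp add: P_def b emW not_le flip: ennreal_mult)
      let ?S = "{y \<in> hcube b r. w y * r ^ ?n \<le> \<beta> * measure (weighted w) (hcube b r)}"
      have S: "measure lebesgue ?S \<le> r ^ ?n / 2"
        using sp r by (auto simp: spread_def)
      \<comment> \<open>The average over a stopped cell exceeds \<open>t\<close>, hence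
        \<open>w \<le> \<beta> t\<close> puts a point into the small-value set that the spread
        condition controls.\<close>
      have sub: "hcube b r - G \<subseteq> ?S"
      proof
        fix y assume y: "y \<in> hcube b r - G"
        then have "w y * r ^ ?n \<le> \<beta> * t * r ^ ?n"
          using r by (intro mult_right_mono) (auto simp: G_def)
        also have "\<dots> \<le> \<beta> * measure (weighted w) (hcube b r)"
          using mult_left_mono[OF less_imp_le[OF low] beta] by (simp add: mult_ac)
        finally show "y \<in> ?S" using y by auto
      qed
      have hl: "hcube b r \<in> lmeasurable"
        using emeasure_hcube[OF r, of b] by (intro fmeasurableI) auto
      have Sl: "?S \<in> lmeasurable"
      proof (rule fmeasurableI2[OF hl])
        have "?S = hcube b r \<inter> {y \<in> space lebesgue. w y * r ^ ?n \<le> \<beta> * measure (weighted w) (hcube b r)}"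
          by auto
        also have "\<dots> \<in> sets lebesgue" by measurable
        finally show "?S \<in> sets lebesgue" .
      qed auto
      have "measure lebesgue (hcube b r) = measure lebesgue (hcube b r \<inter> G) + measure lebesgue (hcube b r - G)"
      proof -
        have "hcube b r \<inter> G \<in> lmeasurable"
          by (rule fmeasurableI2[OF hl]) auto
        then have "measure lebesgue (hcube b r \<inter> G \<union> hcube b r) =
            measure lebesgue (hcube b r \<inter> G) + measure lebesgue (hcube b r - hcube b r \<inter> G)"
          using hl by (rule measure_Un2)
        then show ?thesis by (simp only: Un_absorb1 Int_lower1 Diff_Int Diff_cancel Un_empty_left)
      qed
      moreover have "measure lebesgue (hcube b r - G) \<le> measure lebesgue ?S"
        using sub Sl by (intro measure_mono_fmeasurable) auto
      ultimately have half: "r ^ ?n / 2 \<le> measure lebesgue (hcube b r \<inter> G)"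
        using S measure_hcube[OF r, of b] by linarith
      \<comment> \<open>In \<open>c\<close>, the factor \<open>2 ^ ?n\<close> comes from the parent
        and the remaining 2 from passing to the half of the cell inside \<open>G\<close>.\<close>
      have "emeasure (weighted w) (hcube b r) \<le> ennreal (c * measure lebesgue (hcube b r \<inter> G))"
        unfolding emW[OF r] using up mult_left_mono[OF half c]
        by (intro ennreal_leI) (simp add: c_def mult_ac)
      also have "\<dots> = emeasure N (hcube b r)"
      proof -
        have "hcube b r \<inter> G \<in> lmeasurable" by (rule fmeasurableI2[OF hl]) auto
        then show ?thesis
          using c by (simp only: N hcube_lebesgue ennreal_mult' emeasure_eq_measure2)
      qed
      finally show ?thesis by (simp add: b)
    qed
    show "W \<in> sets lebesgue" "emeasure (weighted w) W \<le> emeasure N W"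
      unfolding W_def by (rule stopping_le[OF l, where M = "weighted w" and N = N]; use key in \<open>auto simp: N_def\<close>)+
  qed
  have WQ: "W \<subseteq> ?Q" using dcell_self by (fastforce simp: W_def P_def)
  define A where "A = {x \<in> hcube a l. (\<forall>k. emeasure (weighted w) (dcell a l k x) \<le>
      ennreal t * emeasure lebesgue (dcell a l k x)) \<and> t < w x}"
  have A: "A \<in> null_sets lebesgue"
    unfolding A_def by (rule null_above_cell_averages[OF l w lam])
  then have A': "A \<in> null_sets (weighted w)"
    by (simp add: null_sets_density_iff) (auto dest: AE_not_in)
  let ?E = "{x \<in> hcube a l. t < w x}"
  \<comment> \<open>A point above \<open>t\<close> outside all stopped cells has only cell averages
    of at most \<open>t\<close>, so it lies in the null set \<open>A\<close>.\<close>
  have "?E \<subseteq> W \<union> A"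
  proof
    fix x assume x: "x \<in> ?E"
    have "dcell a l k x \<subseteq> ?Q" for k
      using dcell_mono[of 0 k a l x] dcell_0[OF l, of x a] x by auto
    then show "x \<in> W \<union> A" using x by (auto simp: W_def A_def P_def)
  qed
  then have "emeasure (weighted w) ?E \<le> emeasure (weighted w) (W \<union> A)"
    using W A by (intro emeasure_mono) auto
  also have "\<dots> = emeasure (weighted w) W"
    using W(1) A' by (simp add: emeasure_Un_null_set)
  also have "\<dots> \<le> ennreal c * emeasure lebesgue (W \<inter> G)"
    using W N by simp
  also have "\<dots> \<le> ennreal c * emeasure lebesgue (?Q \<inter> G)"
    using WQ by (intro mult_left_mono emeasure_mono) auto
  also have "?Q \<inter> G = {x \<in> ?Q. \<beta> * t < w x}" by (auto simp: G_def)
  finally have le: "emeasure (weighted w) ?E \<le> ennreal c * emeasure lebesgue {x \<in> ?Q. \<beta> * t < w x}" .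
  have hl: "hcube a l \<in> lmeasurable"
    using emeasure_hcube[OF l, of a] by (intro fmeasurableI) auto
  then have "{x \<in> ?Q. \<beta> * t < w x} \<in> lmeasurable"
    unfolding \<open>?Q \<inter> G = {x \<in> ?Q. \<beta> * t < w x}\<close>[symmetric] by (rule fmeasurableI2) auto
  then have "emeasure (weighted w) ?E \<le> ennreal (c * measure lebesgue {x \<in> ?Q. \<beta> * t < w x})"
    using le c by (simp only: ennreal_mult' emeasure_eq_measure2)
  then show ?thesis
    unfolding measure_def[of "weighted w"] c_def[symmetric] using c by (intro enn2real_leI) auto
qed

text \<open>The level bound controls the mass above \<open>t\<close> by the volume of
  \<open>{w > \<beta> t}\<close>, which is split at height \<open>T * t\<close>. Chebyshev's
  inequality turns both volumes back into masses. The upper height is written as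
  \<open>A * (\<beta> * t)\<close> so that the lemma iterates along a geometric sequence of
  levels.\<close>

lemma spread_decay:
  fixes a :: "real ^ 'n"
  assumes sp: "spread \<beta> w" and beta: "0 < \<beta>" "\<beta> \<le> 1" and l: "0 < l" and t: "0 < t"
    and avg: "measure (weighted w) (hcube a l) \<le> t * l ^ CARD('n)"
  defines "T \<equiv> 2 ^ (CARD('n) + 2)"
  defines "A \<equiv> T / \<beta>"
  shows "measure (weighted w) {x \<in> hcube a l. A * (\<beta> * t) < w x} \<le>
    A / (1 + A) * measure (weighted w) {x \<in> hcube a l. \<beta> * t < w x}"
proof -
  \<comment> \<open>\<open>T\<close> is twice the constant of the level bound, so that half of the mass above \<open>t\<close> is absorbed.\<close>
  let ?n = "CARD('n)" and ?Q = "hcube a l"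
  have w [measurable]: "w \<in> borel_measurable lebesgue"
    using sp by (auto simp: spread_def)
  have finQ: "emeasure (weighted w) ?Q < \<infinity>"
    using sp l by (auto simp: spread_def)
  define E where "E c = {x \<in> ?Q. c < w x}" for c
  have E [measurable]: "E c \<in> sets lebesgue" for c
  proof -
    have "E c = ?Q \<inter> {x \<in> space lebesgue. c < w x}" by (auto simp: E_def)
    also have "\<dots> \<in> sets lebesgue" by measurable
    finally show ?thesis .
  qed
  have hl: "?Q \<in> lmeasurable"
    using emeasure_hcube[OF l, of a] by (intro fmeasurableI) auto
  have hw: "?Q \<in> fmeasurable (weighted w)"
    using finQ by (intro fmeasurableI) auto
  have lm: "B \<in> lmeasurable" "B \<in> fmeasurable (weighted w)" if "B \<subseteq> ?Q" "B \<in> sets lebesgue" for B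
    using fmeasurableI2[OF hl that] fmeasurableI2[OF hw that(1)] that(2) by auto
  have cheb: "c * measure lebesgue B \<le> measure (weighted w) B"
    if B: "B \<subseteq> ?Q" "B \<in> sets lebesgue" and c: "0 \<le> c" "\<And>x. x \<in> B \<Longrightarrow> c \<le> w x" for c B
  proof -
    have "ennreal (c * measure lebesgue B) = ennreal c * emeasure lebesgue B"
      using lm(1)[OF B] c by (simp only: ennreal_mult' emeasure_eq_measure2)
    also have "\<dots> = (\<integral>\<^sup>+x. ennreal c * indicator B x \<partial>lebesgue)"
      using B by (simp only: nn_integral_cmult_indicator)
    also have "\<dots> \<le> (\<integral>\<^sup>+x. ennreal (w x) * indicator B x \<partial>lebesgue)"
      using c by (intro nn_integral_mono) (auto simp: indicator_def intro: ennreal_leI)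
    also have "\<dots> = emeasure (weighted w) B"
      using B by (simp add: emeasure_density)
    also have "\<dots> = ennreal (measure (weighted w) B)"
      using lm(2)[OF B] by (simp only: emeasure_eq_measure2)
    finally show ?thesis by simp
  qed
  have split: "measure \<mu> (E (\<beta> * t)) = measure \<mu> (E (T * t)) + measure \<mu> (E (\<beta> * t) - E (T * t))"
    if "E (\<beta> * t) \<in> fmeasurable \<mu>" "E (T * t) \<in> fmeasurable \<mu>" "\<beta> \<le> T" for \<mu>
  proof -
    have "E (T * t) \<subseteq> E (\<beta> * t)"
      using t that(3) by (auto simp: E_def dest: less_le_trans[rotated] elim!: le_less_trans[rotated] intro!: mult_right_mono)
    then have "E (T * t) \<union> E (\<beta> * t) = E (\<beta> * t)" by auto
    then show ?thesis using measure_Un2[OF that(2,1)] by simp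
  qed
  have T: "T \<ge> 4" using power_increasing[of 2 "?n + 2" "2::real"] by (simp add: T_def)
  have bT: "\<beta> \<le> T" using T beta by simp
  have A: "A > 0" using T beta by (simp add: A_def)
  have Ab: "A * (\<beta> * t) = T * t" using beta by (simp add: A_def)
  define NE where "NE c = measure (weighted w) (E c)" for c
  have mono: "NE c \<le> NE d" if "d \<le> c" for c d
    unfolding NE_def using that by (intro measure_mono_fmeasurable lm) (auto simp: E_def)
  have "NE (T * t) \<le> A / (1 + A) * NE (\<beta> * t)"
  proof -
    have "NE t \<le> T / 2 * t * measure lebesgue (E (\<beta> * t))"
      using spread_level_bound[OF sp _ l _ avg] beta t by (simp add: E_def T_def NE_def)
    also have "\<dots> = T / 2 * t * measure lebesgue (E (T * t)) + T / 2 * t * measure lebesgue (E (\<beta> * t) - E (T * t))"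
      by (subst split) (auto simp: distrib_left bT E_def intro!: lm E[unfolded E_def])
    also have "T / 2 * t * measure lebesgue (E (T * t)) \<le> NE (T * t) / 2"
    proof -
      have "T * t * measure lebesgue (E (T * t)) \<le> NE (T * t)"
        unfolding NE_def using T t by (intro cheb) (auto simp: E_def)
      then show ?thesis by simp
    qed
    also have "T / 2 * t * measure lebesgue (E (\<beta> * t) - E (T * t)) \<le> A / 2 * (NE (\<beta> * t) - NE (T * t))"
    proof -
      have "\<beta> * t * measure lebesgue (E (\<beta> * t) - E (T * t)) \<le> measure (weighted w) (E (\<beta> * t) - E (T * t))"
        using beta t by (intro cheb) (auto simp: E_def)
      also have "\<dots> = NE (\<beta> * t) - NE (T * t)"
        unfolding NE_def by (subst split) (auto simp: bT E_def intro!: lm E[unfolded E_def])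
      finally have "A / 2 * (\<beta> * t * measure lebesgue (E (\<beta> * t) - E (T * t))) \<le> A / 2 * (NE (\<beta> * t) - NE (T * t))"
        using A by (intro mult_left_mono) auto
      then show ?thesis using beta by (simp add: A_def)
    qed
    \<comment> \<open>Hole filling: replacing \<open>NE t\<close> by the smaller
      \<open>NE (T * t)\<close> leaves that mass with coefficient \<open>1 + A\<close> on the left
      after collecting terms, against \<open>A\<close> on the right.\<close>
    finally have "NE t \<le> NE (T * t) / 2 + A / 2 * (NE (\<beta> * t) - NE (T * t))" by simp
    moreover have "NE (T * t) \<le> NE t"
      using T t by (intro mono) auto
    ultimately have "(1 + A) * NE (T * t) \<le> A * NE (\<beta> * t)"
      by (simp add: field_simps)
    then show ?thesis using A by (simp add: field_simps)
  qed
  then show ?thesis by (simp add: NE_def E_def Ab)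
qed

text \<open>Between consecutive levels of ratio \<open>s\<close>, the factor
  \<open>w powr \<delta>\<close> is at most the upper level to the power \<delta>, while the mass
  above the levels decays like \<open>\<theta> ^ j\<close>. A small \<delta>, depending only on
  \<beta> and the dimension, lets the decay win.\<close>

theorem spread_reverse_Holder:
  assumes beta: "0 < \<beta>" "\<beta> \<le> 1"
  obtains \<delta> C :: real where "0 < \<delta>" "0 \<le> C"
    "\<And>(w :: real ^ 'n \<Rightarrow> real) a l. spread \<beta> w \<Longrightarrow> 0 < l \<Longrightarrow>
      (\<integral>\<^sup>+x\<in>hcube a l. ennreal (w x powr (1 + \<delta>)) \<partial>lebesgue) \<le>
      ennreal (C * (measure (weighted w) (hcube a l) / l ^ CARD('n)) powr (1 + \<delta>) * l ^ CARD('n))"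
proof -
  \<comment> \<open>\<open>s\<close> is the ratio of heights and \<theta> the decay factor of
    \<open>spread_decay\<close>.\<close>
  define s :: real where "s = 2 ^ (CARD('n) + 2) / \<beta>"
  define \<theta> where "\<theta> = s / (1 + s)"
  \<comment> \<open>Chosen so that \<open>s powr \<delta> = 1 / sqrt \<theta>\<close>: the growth of
    the levels uses up only half of the decay exponent.\<close>
  define \<delta> where "\<delta> = ln (1 / sqrt \<theta>) / ln s"
  \<comment> \<open>The 1 accounts for the points below the first level, the fraction for a
    geometric series of ratio \<open>sqrt \<theta>\<close>.\<close>
  define C where "C = 1 + s powr \<delta> / (1 - sqrt \<theta>)"
  have "(4::real) \<le> 2 ^ (CARD('n) + 2)"
    using power_increasing[of 2 "CARD('n) + 2" "2::real"] by simp
  with beta have "\<beta> < 2 ^ (CARD('n) + 2)" by linarith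
  then have s: "s > 1"
    unfolding s_def using beta by (subst less_divide_eq_1_pos)
  have th: "0 < \<theta>" "\<theta> < 1" using s by (auto simp: \<theta>_def)
  then have th': "0 < sqrt \<theta>" "sqrt \<theta> < 1" by auto
  have d: "0 < \<delta>" using s th th' unfolding \<delta>_def by (intro divide_pos_pos) auto
  have sd: "s powr \<delta> = 1 / sqrt \<theta>"
    using s th by (simp add: powr_def \<delta>_def)
  have sdt: "s powr \<delta> * \<theta> = sqrt \<theta>"
    using th by (simp add: sd real_div_sqrt)
  have C: "0 \<le> C" using th' by (simp add: C_def)
  show thesis
  proof (rule that[OF d C])
    fix w :: "real ^ 'n \<Rightarrow> real" and a :: "real ^ 'n" and l :: real
    assume sp: "spread \<beta> w" and l: "0 < l"
    let ?n = "CARD('n)" and ?Q = "hcube a l"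
    have w [measurable]: "w \<in> borel_measurable lebesgue" and w0: "0 \<le> w x" for x
      using sp by (auto simp: spread_def)
    have finQ: "emeasure (weighted w) ?Q < \<infinity>"
      using sp l by (auto simp: spread_def)
    have hw: "?Q \<in> fmeasurable (weighted w)"
      using finQ by (intro fmeasurableI) auto
    define M where "M = measure (weighted w) ?Q"
    define m where "m = M / l ^ ?n"
    have M0: "0 \<le> M" by (simp add: M_def)
    then have m0: "0 \<le> m" using l by (simp add: m_def)
    have emQ: "(\<integral>\<^sup>+x. ennreal (w x) * indicator ?Q x \<partial>lebesgue) = ennreal M"
    proof -
      have "(\<integral>\<^sup>+x. ennreal (w x) * indicator ?Q x \<partial>lebesgue) = emeasure (weighted w) ?Q"
        by (simp add: emeasure_density)
      then show ?thesis using hw by (simp only: M_def emeasure_eq_measure2)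
    qed
    have "(\<integral>\<^sup>+x\<in>?Q. ennreal (w x powr (1 + \<delta>)) \<partial>lebesgue) \<le> ennreal (C * m powr (1 + \<delta>) * l ^ ?n)"
    \<comment> \<open>With zero average, \<open>w\<close> vanishes almost everywhere on the cube and
      there are no positive levels to work with.\<close>
    proof (cases "m = 0")
      case True
      then have "(\<integral>\<^sup>+x. ennreal (w x) * indicator ?Q x \<partial>lebesgue) = 0"
        using l by (simp add: emQ m_def)
      then have "AE x in lebesgue. ennreal (w x) * indicator ?Q x = 0"
        by (subst (asm) nn_integral_0_iff_AE) auto
      then have "AE x in lebesgue. ennreal (w x powr (1 + \<delta>)) * indicator ?Q x = 0"
        by eventually_elim (use w0 in \<open>auto simp: indicator_def ennreal_eq_0_iff antisym split: if_splits\<close>)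
      then have "(\<integral>\<^sup>+x\<in>?Q. ennreal (w x powr (1 + \<delta>)) \<partial>lebesgue) = 0"
        by (subst nn_integral_0_iff_AE) auto
      then show ?thesis by simp
    next
      case False
      then have m: "0 < m" using m0 by simp
      \<comment> \<open>The levels start at \<open>\<beta> * m\<close> because the decay lemma for
        \<open>t = m * s ^ j\<close> compares the heights \<open>\<beta> * t\<close> and
        \<open>s * (\<beta> * t)\<close>, that is, \<open>c j\<close> and
        \<open>c (Suc j)\<close>.\<close>
      define c where "c j = \<beta> * m * s ^ j" for j :: nat
      have c0: "0 < c j" for j using beta m s by (simp add: c_def)
      define E where "E j = {x \<in> ?Q. c j < w x}" for j
      have E [measurable]: "E j \<in> sets lebesgue" for j
      proof -
        have "E j = ?Q \<inter> {x \<in> space lebesgue. c j < w x}" by (auto simp: E_def)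
        also have "\<dots> \<in> sets lebesgue" by measurable
        finally show ?thesis .
      qed
      have Ew: "E j \<in> fmeasurable (weighted w)" for j
        by (rule fmeasurableI2[OF hw]) (auto simp: E_def[of j] E[unfolded E_def])
      have decay: "measure (weighted w) (E j) \<le> \<theta> ^ j * M" for j
      proof (induction j)
        case 0
        have "measure (weighted w) (E 0) \<le> measure (weighted w) ?Q"
          using hw by (intro measure_mono_fmeasurable) (auto simp: E_def E[unfolded E_def])
        then show ?case by (simp add: M_def)
      next
        case (Suc j)
        \<comment> \<open>The height \<open>m * s ^ j\<close> is at least the average
          \<open>m\<close>, as the decay lemma demands.\<close>
        have "M \<le> m * s ^ j * l ^ ?n"
          using l s M0 by (simp add: m_def mult_le_cancel_left1)
        then have "measure (weighted w) {x \<in> ?Q. s * (\<beta> * (m * s ^ j)) < w x} \<le>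
            \<theta> * measure (weighted w) {x \<in> ?Q. \<beta> * (m * s ^ j) < w x}"
          unfolding \<theta>_def s_def
          using m s beta by (intro spread_decay[OF sp beta l]) (auto simp: M_def s_def)
        then have "measure (weighted w) (E (Suc j)) \<le> \<theta> * measure (weighted w) (E j)"
          by (simp add: E_def c_def mult_ac)
        also have "\<dots> \<le> \<theta> * (\<theta> ^ j * M)"
          using Suc th by (intro mult_left_mono) auto
        finally show ?case by (simp add: mult_ac)
      qed
      define b where "b = (\<beta> * m) powr \<delta>"
      have b: "0 \<le> b" "b \<le> m powr \<delta>"
        using beta m d by (auto simp: b_def intro!: powr_mono2)
      have cb: "c (Suc j) powr \<delta> = b * s powr \<delta> * (s powr \<delta>) ^ j" for j
        using beta m s by (simp add: c_def b_def powr_mult powr_power mult_ac flip: powr_realpow)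
          (simp add: powr_powr mult_ac)
      have "(\<integral>\<^sup>+x\<in>?Q. ennreal (w x powr (1 + \<delta>)) \<partial>lebesgue) \<le>
         (\<integral>\<^sup>+x. ennreal b * (ennreal (w x) * indicator ?Q x) +
            (\<Sum>j. ennreal (c (Suc j) powr \<delta>) * (ennreal (w x) * indicator (E j) x)) \<partial>lebesgue)"
      \<comment> \<open>Pointwise bound: the first term serves points with
        \<open>w x \<le> c 0\<close>; any other point is served by the single summand whose levels
        enclose \<open>w x\<close>, the remaining summands being nonnegative.\<close>
      proof (intro nn_integral_mono)
        fix x
        let ?f = "\<lambda>j. ennreal (c (Suc j) powr \<delta>) * (ennreal (w x) * indicator (E j) x)"
        show "ennreal (w x powr (1 + \<delta>)) * indicator ?Q x \<le>
          ennreal b * (ennreal (w x) * indicator ?Q x) + (\<Sum>j. ?f j)"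
        proof (cases "x \<in> ?Q")
          case xQ: True
          have pw: "ennreal (w x powr (1 + \<delta>)) \<le> ennreal (u powr \<delta>) * ennreal (w x)" if "w x \<le> u" for u
          proof -
            have "w x powr (1 + \<delta>) = w x powr \<delta> * w x"
              using w0[of x] by (simp add: powr_add)
            also have "\<dots> \<le> u powr \<delta> * w x"
              using that w0[of x] d by (intro mult_right_mono powr_mono2) auto
            finally have "ennreal (w x powr (1 + \<delta>)) \<le> ennreal (u powr \<delta> * w x)"
              by (rule ennreal_leI)
            then show ?thesis using w0[of x] by (simp only: ennreal_mult powr_ge_zero)
          qed
          show ?thesis
          proof (cases "w x \<le> c 0")
            case True
            then show ?thesis using pw[of "c 0"] xQ
              by (auto simp: c_def b_def intro: add_increasing2)
          next
            case False
            define k where "k = (LEAST k. w x \<le> c k)"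
            have "\<exists>k. w x \<le> c k"
            proof -
              obtain k where "w x / (\<beta> * m) < s ^ k" using real_arch_pow[OF s] by blast
              then show ?thesis using beta m by (auto simp: c_def field_simps intro!: exI[of _ k])
            qed
            then have k: "w x \<le> c k" unfolding k_def by (rule LeastI_ex)
            with False have "k \<noteq> 0" by (metis)
            then obtain j where j: "k = Suc j" by (cases k) auto
            then have "\<not> w x \<le> c j" using not_less_Least[of j "\<lambda>k. w x \<le> c k"] by (simp add: k_def)
            then have "x \<in> E j" using xQ by (simp add: E_def)
            then have "ennreal (w x powr (1 + \<delta>)) * indicator ?Q x \<le> ?f j"
              using pw[of "c (Suc j)"] k j xQ by simp
            also have "\<dots> \<le> (\<Sum>j. ?f j)"
              using sum_le_suminf[of ?f "{j}"] by simp
            finally show ?thesis by (rule add_increasing[rotated]) simp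
          qed
        qed simp
      qed
      also have "\<dots> = ennreal b * ennreal M +
          (\<Sum>j. ennreal (c (Suc j) powr \<delta>) * emeasure (weighted w) (E j))"
        by (subst nn_integral_add) (auto simp: nn_integral_cmult nn_integral_suminf emQ emeasure_density)
      also have "\<dots> \<le> ennreal b * ennreal M +
          (\<Sum>j. ennreal (b * M * s powr \<delta> * sqrt \<theta> ^ j))"
      proof (intro add_left_mono suminf_le)
        fix j
        have "c (Suc j) powr \<delta> * measure (weighted w) (E j) \<le> c (Suc j) powr \<delta> * (\<theta> ^ j * M)"
          using decay by (intro mult_left_mono) auto
        also have "\<dots> = b * M * s powr \<delta> * (s powr \<delta> * \<theta>) ^ j"
          by (simp add: cb power_mult_distrib mult_ac)
        finally have "c (Suc j) powr \<delta> * measure (weighted w) (E j) \<le> b * M * s powr \<delta> * sqrt \<theta> ^ j"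
          by (simp only: sdt)
        then show "ennreal (c (Suc j) powr \<delta>) * emeasure (weighted w) (E j) \<le> ennreal (b * M * s powr \<delta> * sqrt \<theta> ^ j)"
          using Ew[of j] by (simp only: emeasure_eq_measure2) (simp add: ennreal_leI flip: ennreal_mult)
      qed auto
      also have "(\<Sum>j. ennreal (b * M * s powr \<delta> * sqrt \<theta> ^ j)) = ennreal (b * M * s powr \<delta> * (1 / (1 - sqrt \<theta>)))"
      proof -
        have "(\<lambda>j. b * M * s powr \<delta> * sqrt \<theta> ^ j) sums (b * M * s powr \<delta> * (1 / (1 - sqrt \<theta>)))"
          using th' by (intro sums_mult geometric_sums) auto
        then show ?thesis
          using b M0 th' by (subst suminf_ennreal2) (auto simp: sums_iff)
      qed
      also have "ennreal b * ennreal M + \<dots> = ennreal (C * b * M)"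
        using b M0 th' by (simp add: C_def algebra_simps flip: ennreal_mult ennreal_plus)
      also have "\<dots> \<le> ennreal (C * m powr (1 + \<delta>) * l ^ ?n)"
      proof (rule ennreal_leI)
        have "C * b * M \<le> C * m powr \<delta> * M"
          using b M0 C by (intro mult_right_mono mult_left_mono) auto
        also have "\<dots> = C * m powr (1 + \<delta>) * l ^ ?n"
          using l m by (simp add: powr_add) (simp add: m_def)
        finally show "C * b * M \<le> C * m powr (1 + \<delta>) * l ^ ?n" .
      qed
      finally show ?thesis .
    qed
    then show "(\<integral>\<^sup>+x\<in>?Q. ennreal (w x powr (1 + \<delta>)) \<partial>lebesgue) \<le>
      ennreal (C * (measure (weighted w) ?Q / l ^ ?n) powr (1 + \<delta>) * l ^ ?n)"
      by (simp add: m_def M_def)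
  qed
qed

section \<open>Seminorms on Banach spaces\<close>

text \<open>Zorn's lemma is applied to graphs: subspaces of the product with the real line that
  contain \<open>(e, \<rho> e)\<close> and lie below \<rho>. A maximal one is the graph of the
  functional.\<close>

lemma hahn_banach_seminorm:
  fixes \<rho> :: "'x::real_vector \<Rightarrow> real"
  assumes tri: "\<And>x y. \<rho> (x + y) \<le> \<rho> x + \<rho> y"
    and hom: "\<And>c x. \<rho> (c *\<^sub>R x) = \<bar>c\<bar> * \<rho> x"
  obtains f where "linear f" "f e = \<rho> e" "\<And>x. \<bar>f x\<bar> \<le> \<rho> x"
proof -
  define \<A> where "\<A> = {G :: ('x \<times> real) set. subspace G \<and> (e, \<rho> e) \<in> G \<and> (\<forall>(x, t)\<in>G. t \<le> \<rho> x)}"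
  have z: "\<rho> 0 = 0" using hom[of 0 0] by simp
  have nn: "0 \<le> \<rho> x" for x using tri[of x "-1 *\<^sub>R x"] hom[of "-1" x] z by simp
  have "\<exists>M\<in>\<A>. \<forall>X\<in>\<A>. M \<subseteq> X \<longrightarrow> X = M"
  proof (rule subset_Zorn_nonempty)
    have "span {(e, \<rho> e)} \<in> \<A>"
    proof -
      have "\<forall>(x, t)\<in>span {(e, \<rho> e)}. t \<le> \<rho> x"
        using nn by (auto simp: span_singleton hom intro!: mult_right_mono)
      then show ?thesis
        unfolding \<A>_def using subspace_span span_base by blast
    qed
    then show "\<A> \<noteq> {}" by blast
  next
    fix \<C> assume ne: "\<C> \<noteq> {}" and ch: "subset.chain \<A> \<C>"
    have sub: "\<C> \<subseteq> \<A>" and comp: "\<And>G H. G \<in> \<C> \<Longrightarrow> H \<in> \<C> \<Longrightarrow> G \<subseteq> H \<or> H \<subseteq> G"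
      using ch by (auto simp: subset_chain_def)
    have ss: "subspace G" if "G \<in> \<C>" for G using sub that by (auto simp: \<A>_def)
    have "subspace (\<Union>\<C>)"
    proof (rule subspaceI)
      show "0 \<in> \<Union>\<C>" using ne ss subspace_0 by blast
    next
      fix u v assume "u \<in> \<Union>\<C>" "v \<in> \<Union>\<C>"
      then obtain G H where "G \<in> \<C>" "H \<in> \<C>" "u \<in> G" "v \<in> H" by blast
      then show "u + v \<in> \<Union>\<C>"
        using comp[of G H] ss by (meson UnionI subspace_add subsetD)
    next
      fix c u assume "u \<in> \<Union>\<C>"
      then show "c *\<^sub>R u \<in> \<Union>\<C>" using ss subspace_scale by blast
    qed
    then show "\<Union>\<C> \<in> \<A>" using ne sub unfolding \<A>_def by blast
  qed
  then obtain M where M: "M \<in> \<A>" and max: "\<And>X. X \<in> \<A> \<Longrightarrow> M \<subseteq> X \<Longrightarrow> X = M" by blast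
  have sM: "subspace M" and eM: "(e, \<rho> e) \<in> M" and leM: "\<And>x t. (x, t) \<in> M \<Longrightarrow> t \<le> \<rho> x"
    using M by (auto simp: \<A>_def)
  have addM: "(x + y, t + u) \<in> M" if "(x, t) \<in> M" "(y, u) \<in> M" for x y t u
    using subspace_add[OF sM that] by simp
  have scM: "(c *\<^sub>R x, c * t) \<in> M" if "(x, t) \<in> M" for c x t
    using subspace_scale[OF sM that, of c] by simp
  have uniq: "t = u" if "(x, t) \<in> M" "(x, u) \<in> M" for x t u
  proof -
    \<comment> \<open>The difference of the two pairs is \<open>(0, t' - u')\<close>, and \<rho>
      vanishes at 0; lying below \<rho> thus makes the subspace single-valued.\<close>
    have "t' \<le> u'" if "(x, t') \<in> M" "(x, u') \<in> M" for t' u'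
      using leM[OF addM[OF that(1) scM[OF that(2), of "-1"]]] z by simp
    then show ?thesis using that by (meson antisym)
  qed
  have dom: "\<exists>t. (x0, t) \<in> M" for x0
  proof (rule ccontr)
    assume no: "\<nexists>t. (x0, t) \<in> M"
    \<comment> \<open>One-dimensional extension: the value at \<open>x0\<close> must lie above all
      \<open>t - \<rho> (x - x0)\<close> and below all \<open>\<rho> (y + x0) - u\<close>. The
      supremum of the lower bounds works.\<close>
    define L where "L = (\<lambda>(x, t). t - \<rho> (x - x0)) ` M"
    define c where "c = Sup L"
    have bd: "t - \<rho> (x - x0) \<le> \<rho> (y + x0) - u" if "(x, t) \<in> M" "(y, u) \<in> M" for x y t u
      using leM[OF addM[OF that]] tri[of "x - x0" "y + x0"] by simp
    have Lne: "L \<noteq> {}" using eM by (auto simp: L_def)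
    have Lbd: "bdd_above L" using bd[OF _ eM] by (auto simp: L_def intro!: bdd_aboveI)
    have c1: "t - c \<le> \<rho> (x - x0)" if "(x, t) \<in> M" for x t
    proof -
      have "t - \<rho> (x - x0) \<le> c" unfolding c_def
        by (rule cSup_upper[OF _ Lbd]) (use that in \<open>force simp: L_def\<close>)
      then show ?thesis by simp
    qed
    have c2: "u + c \<le> \<rho> (y + x0)" if "(y, u) \<in> M" for y u
    proof -
      have "c \<le> \<rho> (y + x0) - u" unfolding c_def
        by (rule cSup_least[OF Lne]) (use bd[OF _ that] in \<open>auto simp: L_def\<close>)
      then show ?thesis by simp
    qed
    \<comment> \<open>Homogeneity reduces a general coefficient to the two signs, which are
      \<open>c2\<close> and \<open>c1\<close>.\<close>
    have ext: "t + s * c \<le> \<rho> (x + s *\<^sub>R x0)" if xt: "(x, t) \<in> M" for x t s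
    proof (cases s "0 :: real" rule: linorder_cases)
      case equal then show ?thesis using leM[OF xt] by simp
    next
      case greater
      have "s * (t / s + c) \<le> s * \<rho> ((1 / s) *\<^sub>R x + x0)"
        using c2[OF scM[OF xt, of "1 / s"]] greater by (intro mult_left_mono) auto
      also have "\<dots> = \<rho> (s *\<^sub>R ((1 / s) *\<^sub>R x + x0))" using hom greater by simp
      finally show ?thesis using greater by (simp add: algebra_simps)
    next
      case less
      have "(- s) * (t / (- s) - c) \<le> (- s) * \<rho> ((1 / (- s)) *\<^sub>R x - x0)"
        using c1[OF scM[OF xt, of "1 / (- s)"]] less by (intro mult_left_mono) auto
      also have "\<dots> = \<rho> ((- s) *\<^sub>R ((1 / (- s)) *\<^sub>R x - x0))" using hom[of "- s"] less by simp
      finally show ?thesis using less by (simp add: algebra_simps)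
    qed
    let ?N = "span (insert (x0, c) M)"
    have "t \<le> \<rho> x" if "(x, t) \<in> ?N" for x t
    proof -
      have "\<exists>k. (x, t) - k *\<^sub>R (x0, c) \<in> M"
        using that span_eq_iff[THEN iffD2, OF sM] by (simp add: span_insert)
      then obtain k where "(x - k *\<^sub>R x0, t - k * c) \<in> M" by auto
      from ext[OF this, of k] show ?thesis by simp
    qed
    moreover have MN: "M \<subseteq> ?N" and "(x0, c) \<in> ?N" by (auto intro: span_base)
    ultimately have "?N \<in> \<A>" using eM unfolding \<A>_def by auto
    then have "?N = M" using MN by (rule max)
    with \<open>(x0, c) \<in> ?N\<close> no show False by auto
  qed
  define f where "f x = (THE t. (x, t) \<in> M)" for x
  have f: "(x, f x) \<in> M" for x
    unfolding f_def using dom uniq by (metis theI')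
  have f_eq: "f x = t" if "(x, t) \<in> M" for x t using uniq[OF f that] .
  show thesis
  proof (rule that[of f])
    show "linear f"
      by (rule linearI) (auto intro!: f_eq addM scM f)
    show "f e = \<rho> e" using eM by (rule f_eq)
    show "\<bar>f x\<bar> \<le> \<rho> x" for x
      using leM[OF f[of x]] leM[OF scM[OF f[of x], of "-1"]] hom[of "-1" x] by simp
  qed
qed

text \<open>By Baire's theorem one of the closed sets \<open>{x. \<rho> x \<le> real n}\<close> has
  interior points, and translation moves the bound to a ball around 0. A functional dominated by
  such a seminorm is then continuous.\<close>

lemma seminorm_bounded_of_closed_balls:
  fixes \<rho> :: "'x::banach \<Rightarrow> real"
  assumes tri: "\<And>x y. \<rho> (x + y) \<le> \<rho> x + \<rho> y"
    and hom: "\<And>c x. \<rho> (c *\<^sub>R x) = \<bar>c\<bar> * \<rho> x"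
    and closed: "\<And>c. 0 \<le> c \<Longrightarrow> closed {x. \<rho> x \<le> c}"
  obtains K where "\<And>x. \<rho> x \<le> K * norm x"
proof -
  have "\<exists>n::nat. interior {x. \<rho> x \<le> real n} \<noteq> {}"
  proof (rule ccontr)
    assume "\<not> ?thesis"
    then have "closed T \<and> interior T = {}" if "T \<in> range (\<lambda>n::nat. {x. \<rho> x \<le> real n})" for T
      using that closed by auto
    moreover have "Met_TC.mcomplete (TYPE('x))"
      by (simp add: complete_UNIV)
    ultimately have "interior (\<Union>(range (\<lambda>n::nat. {x. \<rho> x \<le> real n}))) = {}"
      using Met_TC.metric_Baire_category_alt[of "range (\<lambda>n::nat. {x. \<rho> x \<le> real n})"]
      by simp
    moreover have "\<Union>(range (\<lambda>n::nat. {x. \<rho> x \<le> real n})) = UNIV"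
      using real_arch_simple by auto
    ultimately show False by simp
  qed
  then obtain n :: nat and x0 where "x0 \<in> interior {x. \<rho> x \<le> real n}" by blast
  then obtain d where d: "d > 0" "ball x0 d \<subseteq> {x. \<rho> x \<le> real n}"
    by (auto simp: mem_interior)
  have z: "\<rho> 0 = 0" using hom[of 0 0] by simp
  have small: "\<rho> x \<le> 2 * real n" if "norm x < d" for x
  proof -
    have "x0 + x \<in> ball x0 d" "x0 \<in> ball x0 d" using that d by (auto simp: dist_norm)
    then have "\<rho> (x0 + x) \<le> real n" "\<rho> x0 \<le> real n" using d(2) by blast+
    then show ?thesis
      using tri[of "x0 + x" "-1 *\<^sub>R x0"] hom[of "-1" x0] by simp
  qed
  show thesis
  proof (rule that)
    fix x
    show "\<rho> x \<le> (4 * real n / d) * norm x"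
    proof (cases "x = 0")
      case False
      \<comment> \<open>This scales \<open>x\<close> to norm \<open>d / 2\<close>, strictly inside
        the ball.\<close>
      define k where "k = d / (2 * norm x)"
      have k: "k > 0" using d False by (simp add: k_def)
      have "norm (k *\<^sub>R x) < d" using False d by (simp add: k_def)
      then have "k * \<rho> x \<le> 2 * real n" using small[of "k *\<^sub>R x"] hom[of k x] k by simp
      then have "\<rho> x \<le> 2 * real n / k" using k by (simp add: field_simps)
      then show ?thesis by (simp add: k_def)
    qed (simp add: z)
  qed
qed

section \<open>The quasi-norms of a weight\<close>

lemma strongly_measurable_norm:
  assumes "strongly_measurable f"
  shows "(\<lambda>x. norm (f x)) \<in> borel_measurable lebesgue"
proof -
  obtain s where s: "\<And>k::nat. simple_function lebesgue (s k)" "\<And>x. (\<lambda>k. s k x) \<longlonglongrightarrow> f x"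
    using assms by (auto simp: strongly_measurable_def)
  show ?thesis
  proof (rule borel_measurable_LIMSEQ_real)
    show "(\<lambda>k. norm (s k x)) \<longlonglongrightarrow> norm (f x)" for x
      using s(2) by (rule tendsto_norm)
    have "simple_function lebesgue (\<lambda>x. norm (s k x))" for k
      using simple_function_compose[OF s(1), of norm k] by (simp add: o_def)
    then show "(\<lambda>x. norm (s k x)) \<in> borel_measurable lebesgue" for k
      by (rule borel_measurable_simple_function)
  qed
qed

lemma cubes_measure:
  assumes "Q \<in> cubes"
  shows "emeasure lebesgue Q = ennreal (measure lebesgue Q)" "0 < measure lebesgue Q"
    "Q \<in> sets lebesgue" "Q \<in> lmeasurable"
proof -
  obtain a and l :: real where Q: "Q = cbox a (a + (\<chi> i. l))" "0 < l"
    using assms by (auto simp: cubes_def)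
  show "Q \<in> sets lebesgue" "Q \<in> lmeasurable" by (simp_all add: Q)
  then show "emeasure lebesgue Q = ennreal (measure lebesgue Q)"
    by (simp only: emeasure_eq_measure2)
  then have "ennreal (measure lebesgue Q) = ennreal (l ^ CARD('a))"
    unfolding Q using emeasure_cube[OF Q(2), of a] by simp
  then show "0 < measure lebesgue Q"
    using Q(2) by (metis ennreal_inj less_eq_real_def measure_nonneg zero_less_power)
qed

lemma rho_finite_exponent:
  assumes "0 < q"
  shows "rho (ennreal q) U Q e = ennreal_powr
    ((\<integral>\<^sup>+x\<in>Q. ennreal (norm (U x e) powr q) \<partial>lebesgue) / emeasure lebesgue Q) (1 / q)"
  using assms by (simp add: rho_def)

text \<open>Removes the root and the average, so that later estimates can be made on integrals. An
  infinite integral makes both sides false.\<close>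

lemma rho_le_iff:
  assumes q: "0 < q" and Q: "Q \<in> cubes" and c: "0 \<le> c"
  shows "rho (ennreal q) U Q e \<le> ennreal c \<longleftrightarrow>
    (\<integral>\<^sup>+x\<in>Q. ennreal (norm (U x e) powr q) \<partial>lebesgue) \<le> ennreal (c powr q * measure lebesgue Q)"
    (is "_ \<longleftrightarrow> ?I \<le> _")
proof (cases "?I = \<infinity>")
  case True
  then have "?I / emeasure lebesgue Q = \<infinity>"
    unfolding cubes_measure(1)[OF Q] by (simp add: ennreal_top_divide)
  then show ?thesis
    unfolding rho_finite_exponent[OF q] using True by (simp add: ennreal_powr_def top_unique)
next
  case False
  define v where "v = measure lebesgue Q"
  have v: "0 < v" using cubes_measure[OF Q] by (simp add: v_def)
  from False obtain i where i: "?I = ennreal i" "0 \<le> i" by (cases ?I) auto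
  have "rho (ennreal q) U Q e = ennreal ((i / v) powr (1 / q))"
    unfolding rho_finite_exponent[OF q] i(1) cubes_measure(1)[OF Q] v_def[symmetric]
    using v i(2) by (simp add: divide_ennreal ennreal_powr_def)
  moreover have "(i / v) powr (1 / q) \<le> c \<longleftrightarrow> i \<le> c powr q * v"
  proof
    assume "(i / v) powr (1 / q) \<le> c"
    then have "((i / v) powr (1 / q)) powr q \<le> c powr q"
      using q by (intro powr_mono2) auto
    then show "i \<le> c powr q * v" using q v i(2) by (simp add: powr_powr field_simps)
  next
    assume "i \<le> c powr q * v"
    then have "i / v \<le> c powr q" using v by (simp add: field_simps)
    then have "(i / v) powr (1 / q) \<le> (c powr q) powr (1 / q)"
      using q v i(2) by (intro powr_mono2) auto
    then show "(i / v) powr (1 / q) \<le> c" using q c by (simp add: powr_powr)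
  qed
  ultimately show ?thesis
    using c v by (simp add: i(1) v_def ennreal_le_iff)
qed

lemma rho_lt_top_iff:
  assumes q: "0 < q" and Q: "Q \<in> cubes"
  shows "rho (ennreal q) U Q e < \<infinity> \<longleftrightarrow> (\<integral>\<^sup>+x\<in>Q. ennreal (norm (U x e) powr q) \<partial>lebesgue) < \<infinity>"
    (is "_ \<longleftrightarrow> ?I < _")
proof
  assume "rho (ennreal q) U Q e < \<infinity>"
  then obtain r where "rho (ennreal q) U Q e = ennreal r" "0 \<le> r"
    by (cases "rho (ennreal q) U Q e") auto
  then have "?I \<le> ennreal (r powr q * measure lebesgue Q)"
    using rho_le_iff[OF q Q, of r U e] by simp
  then show "?I < \<infinity>" by (rule le_less_trans) simp
next
  assume "?I < \<infinity>"
  then obtain i where "?I = ennreal i" "0 \<le> i" by (cases ?I) auto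
  then have "?I / emeasure lebesgue Q < \<infinity>"
    unfolding cubes_measure(1)[OF Q] using cubes_measure(2)[OF Q] by (simp add: divide_ennreal)
  then show "rho (ennreal q) U Q e < \<infinity>"
    unfolding rho_finite_exponent[OF q] by (simp add: ennreal_powr_def)
qed

text \<open>Finiteness matters because \<open>enn2real\<close> would send an infinite quasi-norm to
  0.\<close>

lemma integral_eq_rho:
  assumes q: "0 < q" and Q: "Q \<in> cubes" and fin: "rho (ennreal q) U Q e < \<infinity>"
  shows "(\<integral>\<^sup>+x\<in>Q. ennreal (norm (U x e) powr q) \<partial>lebesgue) =
    ennreal (enn2real (rho (ennreal q) U Q e) powr q * measure lebesgue Q)"
    (is "?I = _")
proof -
  define v where "v = measure lebesgue Q"
  have v: "0 < v" using cubes_measure[OF Q] by (simp add: v_def)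
  from fin rho_lt_top_iff[OF q Q, of U e] obtain i where i: "?I = ennreal i" "0 \<le> i" by (cases ?I) auto
  have "rho (ennreal q) U Q e = ennreal ((i / v) powr (1 / q))"
    unfolding rho_finite_exponent[OF q] i(1) cubes_measure(1)[OF Q] v_def[symmetric]
    using v i(2) by (simp add: divide_ennreal ennreal_powr_def)
  then show ?thesis
    using q v i(2) by (simp add: i(1) v_def[symmetric] powr_powr)
qed

lemma p_weight_rho_lt_top:
  assumes q: "0 < q" and pw: "p_weight (ennreal q) U" and Q: "Q \<in> cubes"
  shows "rho (ennreal q) U Q e < \<infinity>"
proof -
  have "(\<integral>\<^sup>+x. ennreal (norm (indicat_real Q x *\<^sub>R U x e) powr q) \<partial>lebesgue) < \<infinity>"
    using pw Q q by (simp add: p_weight_def in_Lp_def)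
  also have "(\<integral>\<^sup>+x. ennreal (norm (indicat_real Q x *\<^sub>R U x e) powr q) \<partial>lebesgue) =
      (\<integral>\<^sup>+x\<in>Q. ennreal (norm (U x e) powr q) \<partial>lebesgue)"
    by (intro nn_integral_cong) (auto simp: indicator_def)
  finally show ?thesis using rho_lt_top_iff[OF q Q, of U e] by simp
qed

section \<open>Positivity, semicontinuity and seminorm laws\<close>

lemma blinfun_inv_left:
  assumes "blinfun_invertible T"
  shows "blinfun_inv T (T e) = e" "T (blinfun_inv T e) = e"
proof -
  obtain S where S: "blinfun_is_inverse T S" using assms by (auto simp: blinfun_invertible_def)
  have "S (T e) = (S o\<^sub>L T) e" "T (S e) = (T o\<^sub>L S) e" by simp_all
  then show "blinfun_inv T (T e) = e" "T (blinfun_inv T e) = e"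
    using S by (simp_all only: blinfun_inv_eq[OF S] blinfun_is_inverse_def blinfun_apply_id_blinfun)
qed

text \<open>A vanishing quasi-norm forces \<open>U x e = 0\<close> almost everywhere on a cube of
  positive volume, against invertibility almost everywhere.\<close>

lemma rho_pos:
  assumes q: "0 < q" and w: "weight U" and Q: "Q \<in> cubes" and e: "e \<noteq> 0"
  shows "0 < rho (ennreal q) U Q e"
proof (rule ccontr)
  assume "\<not> 0 < rho (ennreal q) U Q e"
  then have "rho (ennreal q) U Q e \<le> ennreal 0" by simp
  then have "(\<integral>\<^sup>+x\<in>Q. ennreal (norm (U x e) powr q) \<partial>lebesgue) = 0"
    unfolding rho_le_iff[OF q Q order_refl] by simp
  moreover have [measurable]: "(\<lambda>x. norm (U x e)) \<in> borel_measurable lebesgue" "Q \<in> sets lebesgue"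
    using w Q by (auto simp: weight_def intro: strongly_measurable_norm cubes_measure)
  ultimately have "AE x in lebesgue. ennreal (norm (U x e) powr q) * indicator Q x = 0"
    by (subst (asm) nn_integral_0_iff_AE) auto
  moreover have "AE x in lebesgue. blinfun_invertible (U x)"
    using w by (simp add: weight_def)
  ultimately have "AE x in lebesgue. x \<notin> Q"
  proof eventually_elim
    case (elim x)
    have "U x e \<noteq> 0"
      using blinfun_inv_left(1)[OF elim(2), of e] e by (metis blinfun.zero_right)
    then show ?case using elim(1) by (auto simp: indicator_def split: if_splits)
  qed
  then have "emeasure lebesgue Q = 0"
    using \<open>Q \<in> sets lebesgue\<close> by (simp only: AE_iff_null_sets[symmetric] null_setsD1)
  then show False using cubes_measure[OF Q] by simp
qed

text \<open>Fatou's lemma, since each operator \<open>U x\<close> is continuous.\<close>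

lemma rho_lower_semicontinuous:
  fixes U :: "real ^ 'n \<Rightarrow> ('x::real_normed_vector \<Rightarrow>\<^sub>L 'x)"
  assumes q: "0 < q" and Q: "Q \<in> cubes" and c: "0 \<le> c"
    and meas: "\<And>e. strongly_measurable (\<lambda>x. U x e)"
    and lim: "(\<lambda>k. d k) \<longlonglongrightarrow> e" and le: "\<And>k. rho (ennreal q) U Q (d k) \<le> ennreal c"
  shows "rho (ennreal q) U Q e \<le> ennreal c"
proof -
  have [measurable]: "(\<lambda>x. norm (U x f)) \<in> borel_measurable lebesgue" "Q \<in> sets lebesgue" for f
    using meas Q by (auto intro: strongly_measurable_norm cubes_measure)
  have lim': "(\<lambda>k. ennreal (norm (U x (d k)) powr q) * indicator Q x) \<longlonglongrightarrow>
      ennreal (norm (U x e) powr q) * indicator Q x" for x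
  proof (cases "x \<in> Q")
    case True
    have "(\<lambda>k. norm (U x (d k)) powr q) \<longlonglongrightarrow> norm (U x e) powr q"
      using lim q by (intro tendsto_powr' tendsto_norm blinfun.tendsto) auto
    then show ?thesis using True by (simp add: tendsto_ennrealI)
  qed simp
  have "(\<integral>\<^sup>+x. ennreal (norm (U x e) powr q) * indicator Q x \<partial>lebesgue) =
      (\<integral>\<^sup>+x. liminf (\<lambda>k. ennreal (norm (U x (d k)) powr q) * indicator Q x) \<partial>lebesgue)"
    by (intro nn_integral_cong lim_imp_Liminf[symmetric] lim') auto
  also have "\<dots> \<le> liminf (\<lambda>k. \<integral>\<^sup>+x. ennreal (norm (U x (d k)) powr q) * indicator Q x \<partial>lebesgue)"
    by (intro nn_integral_liminf) measurable
  also have "\<dots> \<le> ennreal (c powr q * measure lebesgue Q)"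
    using le unfolding rho_le_iff[OF q Q c]
    by (intro Liminf_le always_eventually) auto
  finally show ?thesis unfolding rho_le_iff[OF q Q c] .
qed

text \<open>Convexity of the power at the points \<open>u / A\<close> and \<open>w / B\<close> with
  weights \<open>A / (A + B)\<close> and \<open>B / (A + B)\<close>; this is the pointwise form of
  Minkowski's inequality.\<close>

lemma powr_sum_le:
  fixes u w A B q :: real
  assumes q: "1 \<le> q" and uw: "0 \<le> u" "0 \<le> w" and AB: "0 < A" "0 < B"
  shows "(u + w) powr q \<le> (A + B) powr q * (A / (A + B) * (u / A) powr q + B / (A + B) * (w / B) powr q)"
proof -
  \<comment> \<open>When one summand vanishes, the claim reduces to monotonicity of the power
    \<open>q - 1\<close>.\<close>
  have zero: "v powr q \<le> (D + E) powr q * (D / (D + E) * (v / D) powr q)"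
    if "0 < D" "0 < E" "0 \<le> v" for v D E
  proof -
    have "D powr (q - 1) \<le> (D + E) powr (q - 1)" using q that by (intro powr_mono2) auto
    then have "D powr (q - 1) * v powr q \<le> (D + E) powr (q - 1) * v powr q"
      by (rule mult_right_mono) simp
    then have "v powr q \<le> (D + E) powr (q - 1) * v powr q / D powr (q - 1)"
      using that by (simp add: pos_le_divide_eq mult.commute)
    also have "\<dots> = (D + E) powr q * (D / (D + E) * (v / D) powr q)"
      using that by (simp add: powr_divide powr_diff)
    finally show ?thesis .
  qed
  show ?thesis
  proof (cases "u = 0 \<or> w = 0")
    case True
    then show ?thesis
      using zero[of A B u] zero[of B A w] AB uw q by (auto simp: add.commute)
  next
    case False
    let ?s = "B / (A + B)"
    have s: "1 - ?s = A / (A + B)" "0 \<le> ?s" "?s \<le> 1" using AB by (auto simp: field_simps)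
    have "((1 - ?s) *\<^sub>R (u / A) + ?s *\<^sub>R (w / B)) powr q \<le> (1 - ?s) * (u / A) powr q + ?s * (w / B) powr q"
      using False uw AB s by (intro convex_onD[OF powr_convex[OF q]]) auto
    also have "(1 - ?s) *\<^sub>R (u / A) + ?s *\<^sub>R (w / B) = (u + w) / (A + B)"
      unfolding s using AB by (simp add: add_divide_distrib)
    finally have "(A + B) powr q * ((u + w) / (A + B)) powr q \<le>
        (A + B) powr q * (A / (A + B) * (u / A) powr q + ?s * (w / B) powr q)"
      unfolding s by (intro mult_left_mono) auto
    moreover have "(A + B) powr q * ((u + w) / (A + B)) powr q = (u + w) powr q"
      using uw AB by (simp add: powr_divide)
    ultimately show ?thesis by simp
  qed
qed

text \<open>Minkowski's inequality: once the two norms are normalised by \<open>A\<close> and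
  \<open>B\<close>, their integrals are at most the volume, and \<open>powr_sum_le\<close>
  integrates to \<open>(A + B) powr q\<close> times the volume.\<close>

lemma rho_triangle:
  fixes U :: "real ^ 'n \<Rightarrow> ('x::real_normed_vector \<Rightarrow>\<^sub>L 'x)"
  assumes q: "1 \<le> q" and Q: "Q \<in> cubes"
    and meas: "\<And>e. strongly_measurable (\<lambda>x. U x e)"
    and fin: "\<And>e. rho (ennreal q) U Q e < \<infinity>"
  shows "enn2real (rho (ennreal q) U Q (d + e)) \<le>
    enn2real (rho (ennreal q) U Q d) + enn2real (rho (ennreal q) U Q e)"
proof (rule field_le_epsilon)
  fix \<epsilon> :: real assume eps: "0 < \<epsilon>"
  have q0: "0 < q" using q by simp
  have [measurable]: "(\<lambda>x. norm (U x f)) \<in> borel_measurable lebesgue" "Q \<in> sets lebesgue" for f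
    using meas Q by (auto intro: strongly_measurable_norm cubes_measure)
  define v where "v = measure lebesgue Q"
  \<comment> \<open>Half of \<epsilon> is added to each norm so that the divisors \<open>A\<close>
    and \<open>B\<close> are positive even if a norm is 0.\<close>
  define A where "A = enn2real (rho (ennreal q) U Q d) + \<epsilon> / 2"
  define B where "B = enn2real (rho (ennreal q) U Q e) + \<epsilon> / 2"
  have A: "0 < A" and B: "0 < B" using eps by (auto simp: A_def B_def add_nonneg_pos)
  have le: "(\<integral>\<^sup>+x\<in>Q. ennreal (norm (U x f) powr q) \<partial>lebesgue) \<le> ennreal (D powr q * v)"
    if "enn2real (rho (ennreal q) U Q f) \<le> D" "0 < D" for f D
    unfolding v_def
    using that fin[of f] rho_le_iff[OF q0 Q, of D U f] by (simp add: less_top flip: enn2real_le_iff)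
  let ?f = "\<lambda>x. ennreal ((A + B) powr q * (A / (A + B)) / A powr q) * (ennreal (norm (U x d) powr q) * indicator Q x)"
  let ?g = "\<lambda>x. ennreal ((A + B) powr q * (B / (A + B)) / B powr q) * (ennreal (norm (U x e) powr q) * indicator Q x)"
  have "(\<integral>\<^sup>+x\<in>Q. ennreal (norm (U x (d + e)) powr q) \<partial>lebesgue) \<le> (\<integral>\<^sup>+x. ?f x + ?g x \<partial>lebesgue)"
  proof (rule nn_integral_mono)
    fix x
    have "norm (U x (d + e)) powr q \<le> (norm (U x d) + norm (U x e)) powr q"
      using q by (intro powr_mono2) (auto simp: blinfun.add_right norm_triangle_ineq)
    also note powr_sum_le[OF q norm_ge_zero norm_ge_zero A B]
    finally have "norm (U x (d + e)) powr q \<le> (A + B) powr q * (A / (A + B)) / A powr q * norm (U x d) powr q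
        + (A + B) powr q * (B / (A + B)) / B powr q * norm (U x e) powr q"
      using A B by (simp add: powr_divide distrib_left)
    then have "ennreal (norm (U x (d + e)) powr q) \<le> ennreal ((A + B) powr q * (A / (A + B)) / A powr q * norm (U x d) powr q
        + (A + B) powr q * (B / (A + B)) / B powr q * norm (U x e) powr q)"
      by (rule ennreal_leI)
    also have "\<dots> = ennreal ((A + B) powr q * (A / (A + B)) / A powr q) * ennreal (norm (U x d) powr q)
        + ennreal ((A + B) powr q * (B / (A + B)) / B powr q) * ennreal (norm (U x e) powr q)"
    proof -
      have "ennreal (a * u + b * w) = ennreal a * ennreal u + ennreal b * ennreal w"
        if "0 \<le> a" "0 \<le> b" "0 \<le> u" "0 \<le> w" for a b u w
        using that by (simp add: ennreal_mult)
      note split = this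
      show ?thesis by (rule split) (use A B in auto)
    qed
    finally show "ennreal (norm (U x (d + e)) powr q) * indicator Q x \<le> ?f x + ?g x"
      by (auto simp: indicator_def)
  qed
  also have "\<dots> = ennreal ((A + B) powr q * (A / (A + B)) / A powr q) * (\<integral>\<^sup>+x\<in>Q. ennreal (norm (U x d) powr q) \<partial>lebesgue)
      + ennreal ((A + B) powr q * (B / (A + B)) / B powr q) * (\<integral>\<^sup>+x\<in>Q. ennreal (norm (U x e) powr q) \<partial>lebesgue)"
    by (subst nn_integral_add) (auto simp: nn_integral_cmult)
  also have "\<dots> \<le> ennreal ((A + B) powr q * (A / (A + B)) / A powr q) * ennreal (A powr q * v)
      + ennreal ((A + B) powr q * (B / (A + B)) / B powr q) * ennreal (B powr q * v)"
    using A B eps by (intro add_mono mult_left_mono le) (auto simp: A_def B_def)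
  also have "\<dots> = ennreal ((A + B) powr q * (A / (A + B)) * v + (A + B) powr q * (B / (A + B)) * v)"
    using A B by (subst ennreal_plus) (auto simp: v_def mult_ac simp flip: ennreal_mult)
  also have "(A + B) powr q * (A / (A + B)) * v + (A + B) powr q * (B / (A + B)) * v = (A + B) powr q * v"
  proof -
    have "A / (A + B) + B / (A + B) = 1" using A B by (simp flip: add_divide_distrib)
    then show ?thesis by (metis distrib_left distrib_right mult.right_neutral)
  qed
  finally have "rho (ennreal q) U Q (d + e) \<le> ennreal (A + B)"
    unfolding v_def using A B by (subst rho_le_iff[OF q0 Q]) auto
  then have "enn2real (rho (ennreal q) U Q (d + e)) \<le> A + B"
    using A B by (intro enn2real_leI) auto
  then show "enn2real (rho (ennreal q) U Q (d + e)) \<le>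
      enn2real (rho (ennreal q) U Q d) + enn2real (rho (ennreal q) U Q e) + \<epsilon>"
    by (simp add: A_def B_def)
qed

lemma rho_scale:
  fixes U :: "real ^ 'n \<Rightarrow> ('x::real_normed_vector \<Rightarrow>\<^sub>L 'x)"
  assumes q: "0 < q" and Q: "Q \<in> cubes"
    and meas: "\<And>e. strongly_measurable (\<lambda>x. U x e)"
    and fin: "\<And>e. rho (ennreal q) U Q e < \<infinity>"
  shows "enn2real (rho (ennreal q) U Q (c *\<^sub>R e)) = \<bar>c\<bar> * enn2real (rho (ennreal q) U Q e)"
proof -
  define r where "r e = enn2real (rho (ennreal q) U Q e)" for e
  have [measurable]: "(\<lambda>x. norm (U x f)) \<in> borel_measurable lebesgue" "Q \<in> sets lebesgue" for f
    using meas Q by (auto intro: strongly_measurable_norm cubes_measure)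
  have r0: "0 \<le> r e" for e by (simp add: r_def)
  have le: "r (c *\<^sub>R e) \<le> \<bar>c\<bar> * r e" for c e
  proof -
    have "(\<integral>\<^sup>+x\<in>Q. ennreal (norm (U x (c *\<^sub>R e)) powr q) \<partial>lebesgue) =
        (\<integral>\<^sup>+x. ennreal (\<bar>c\<bar> powr q) * (ennreal (norm (U x e) powr q) * indicator Q x) \<partial>lebesgue)"
      by (intro nn_integral_cong)
        (auto simp: blinfun.scaleR_right powr_mult indicator_def simp flip: ennreal_mult)
    also have "\<dots> = ennreal (\<bar>c\<bar> powr q) * ennreal (r e powr q * measure lebesgue Q)"
      by (subst nn_integral_cmult) (auto simp: integral_eq_rho[OF q Q fin] r_def)
    also have "\<dots> = ennreal ((\<bar>c\<bar> * r e) powr q * measure lebesgue Q)"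
      using r0[of e] by (simp add: powr_mult mult_ac flip: ennreal_mult)
    finally have "rho (ennreal q) U Q (c *\<^sub>R e) \<le> ennreal (\<bar>c\<bar> * r e)"
      using r0[of e] by (subst rho_le_iff[OF q Q]) auto
    then show ?thesis
      unfolding r_def[of "c *\<^sub>R e"] using r0[of e] by (intro enn2real_leI) auto
  qed
  have "r (c *\<^sub>R e) = \<bar>c\<bar> * r e"
  proof (cases "c = 0")
    case True
    then show ?thesis using le[of 0 e] r0[of 0] by simp
  next
    case False
    \<comment> \<open>The reverse inequality is the one already shown, applied to the factor
      \<open>1 / c\<close>.\<close>
    have "r e \<le> \<bar>1 / c\<bar> * r (c *\<^sub>R e)" using le[of "1 / c" "c *\<^sub>R e"] False by simp
    then have "\<bar>c\<bar> * r e \<le> r (c *\<^sub>R e)" using False by (simp add: field_simps)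
    then show ?thesis using le[of c e] by simp
  qed
  then show ?thesis by (simp add: r_def)
qed

text \<open>Chebyshev's inequality at twice the bound on the mean: the exceptional fraction is at
  most \<open>(1 / 2) powr q\<close>, hence at most one half as \<open>q \<ge> 1\<close>. This is
  the source of the one half in the spread condition.\<close>

lemma rho_chebyshev:
  fixes U :: "real ^ 'n \<Rightarrow> ('x::real_normed_vector \<Rightarrow>\<^sub>L 'x)"
  assumes q: "1 \<le> q" and Q: "Q \<in> cubes" and meas: "strongly_measurable (\<lambda>x. U x f)"
    and s: "0 < s" and le: "rho (ennreal q) U Q f \<le> ennreal (s / 2)"
  shows "measure lebesgue {x \<in> Q. s \<le> norm (U x f)} \<le> measure lebesgue Q / 2"
    and "{x \<in> Q. s \<le> norm (U x f)} \<in> lmeasurable"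
proof -
  have q0: "0 < q" using q by simp
  have m [measurable]: "(\<lambda>x. norm (U x f)) \<in> borel_measurable lebesgue" "Q \<in> sets lebesgue"
    using meas Q by (auto intro: strongly_measurable_norm cubes_measure)
  let ?S = "{x \<in> Q. s \<le> norm (U x f)}"
  have "?S = Q \<inter> {x \<in> space lebesgue. s \<le> norm (U x f)}" by auto
  also have "\<dots> \<in> sets lebesgue" by measurable
  finally have S: "?S \<in> sets lebesgue" .
  then show Sl: "?S \<in> lmeasurable"
    by (intro fmeasurableI2[OF cubes_measure(4)[OF Q]]) auto
  have "ennreal (s powr q * measure lebesgue ?S) = ennreal (s powr q) * emeasure lebesgue ?S"
    using Sl by (simp only: ennreal_mult' powr_ge_zero emeasure_eq_measure2)
  also have "\<dots> = (\<integral>\<^sup>+x. ennreal (s powr q) * indicator ?S x \<partial>lebesgue)"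
    using S by (simp only: nn_integral_cmult_indicator)
  also have "\<dots> \<le> (\<integral>\<^sup>+x\<in>Q. ennreal (norm (U x f) powr q) \<partial>lebesgue)"
    using s q by (intro nn_integral_mono) (auto simp: indicator_def intro!: ennreal_leI powr_mono2)
  also have "\<dots> \<le> ennreal ((s / 2) powr q * measure lebesgue Q)"
    using le s by (subst (asm) rho_le_iff[OF q0 Q]) auto
  finally have "s powr q * measure lebesgue ?S \<le> (s / 2) powr q * measure lebesgue Q"
    by (subst (asm) ennreal_le_iff) auto
  then have "measure lebesgue ?S \<le> (1 / 2) powr q * measure lebesgue Q"
    using s by (simp add: powr_divide field_simps)
  also have "(1 / 2 :: real) powr q \<le> (1 / 2) powr 1"
    using q by (intro powr_mono') auto
  then have "(1 / 2) powr q * measure lebesgue Q \<le> 1 / 2 * measure lebesgue Q"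
    by (intro mult_right_mono) auto
  finally show "measure lebesgue ?S \<le> measure lebesgue Q / 2" by simp
qed

section \<open>Weights in the Muckenhoupt class\<close>

text \<open>The bad set is only required to lie in \<open>S\<close> up to a null set, because weights are invertible only
  almost everywhere.\<close>
definition rho_nondegenerate ::
    "real \<Rightarrow> real \<Rightarrow> (real ^ 'n \<Rightarrow> ('x::real_normed_vector \<Rightarrow>\<^sub>L 'x)) \<Rightarrow> bool" where
  "rho_nondegenerate b q U \<longleftrightarrow> (\<forall>Q\<in>cubes. \<forall>e. e \<noteq> 0 \<longrightarrow>
     (\<exists>S\<in>lmeasurable. measure lebesgue S \<le> measure lebesgue Q / 2 \<and>
        (AE x in lebesgue. x \<in> Q \<longrightarrow> norm (U x e) \<le> b * enn2real (rho (ennreal q) U Q e) \<longrightarrow> x \<in> S)))"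

lemma rho_nondegenerateI:
  fixes U :: "real ^ 'n \<Rightarrow> ('x::real_normed_vector \<Rightarrow>\<^sub>L 'x)"
  assumes "\<And>Q e. Q \<in> cubes \<Longrightarrow> e \<noteq> 0 \<Longrightarrow> \<exists>S\<in>lmeasurable. measure lebesgue S \<le> measure lebesgue Q / 2 \<and>
    (AE x in lebesgue. x \<in> Q \<longrightarrow> norm (U x e) \<le> b * enn2real (rho (ennreal q) U Q e) \<longrightarrow> x \<in> S)"
  shows "rho_nondegenerate b q U"
  using assms by (auto simp: rho_nondegenerate_def)

section \<open>From operator weights to scalar weights\<close>

lemma measure_cube:
  fixes a :: "real ^ 'n"
  assumes "0 < l"
  shows "measure lebesgue (cbox a (a + (\<chi> i. l))) = l ^ CARD('n)"
  unfolding measure_def emeasure_cube[OF assms] using assms by simp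

text \<open>Taking powers of exponent \<open>q\<close> turns the pointwise comparison with the
  quasi-norm into a comparison with the average of the scalar weight; \<open>b\<close> becomes
  \<open>b powr q\<close>, whatever \<open>e\<close> is.\<close>

lemma rho_nondegenerate_spread:
  fixes U :: "real ^ 'n \<Rightarrow> ('x::real_normed_vector \<Rightarrow>\<^sub>L 'x)"
  assumes q: "0 < q" and b: "0 < b" and nd: "rho_nondegenerate b q U"
    and pw: "p_weight (ennreal q) U" and e: "e \<noteq> 0"
  shows "spread (b powr q) (\<lambda>x. norm (U x e) powr q)"
    and "0 < l \<Longrightarrow> measure (weighted (\<lambda>x. norm (U x e) powr q)) (hcube a l) =
      enn2real (rho (ennreal q) U (cbox a (a + (\<chi> i. l))) e) powr q * l ^ CARD('n)"
proof -
  let ?w = "\<lambda>x. norm (U x e) powr q"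
  have [measurable]: "(\<lambda>x. norm (U x e)) \<in> borel_measurable lebesgue"
    using pw by (auto simp: p_weight_def weight_def intro: strongly_measurable_norm)
  have *: "emeasure (weighted ?w) (hcube a l) =
      ennreal (enn2real (rho (ennreal q) U (cbox a (a + (\<chi> i. l))) e) powr q * l ^ CARD('n))"
    if l: "0 < l" for a l
  proof -
    let ?Q = "cbox a (a + (\<chi> i. l))"
    have Q: "?Q \<in> cubes" using l by (auto simp: cubes_def)
    have "emeasure (weighted ?w) (hcube a l) = (\<integral>\<^sup>+x\<in>hcube a l. ennreal (?w x) \<partial>lebesgue)"
      by (simp add: emeasure_density)
    also have "\<dots> = (\<integral>\<^sup>+x\<in>?Q. ennreal (?w x) \<partial>lebesgue)"
      using AE_hcube_iff_cbox[of a l] by (intro nn_integral_cong_AE) (auto elim!: eventually_mono simp: indicator_def)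
    also have "\<dots> = ennreal (enn2real (rho (ennreal q) U ?Q e) powr q * l ^ CARD('n))"
      using integral_eq_rho[OF q Q p_weight_rho_lt_top[OF q pw Q]] by (simp only: measure_cube[OF l])
    finally show ?thesis .
  qed
  have **: "measure (weighted ?w) (hcube a l) =
      enn2real (rho (ennreal q) U (cbox a (a + (\<chi> i. l))) e) powr q * l ^ CARD('n)"
    if "0 < l" for a l
    unfolding measure_def *[OF that] using that by simp
  then show "0 < l \<Longrightarrow> measure (weighted ?w) (hcube a l) =
      enn2real (rho (ennreal q) U (cbox a (a + (\<chi> i. l))) e) powr q * l ^ CARD('n)" .
  show "spread (b powr q) ?w"
    unfolding spread_def
  proof (intro conjI allI impI)
    show "?w \<in> borel_measurable lebesgue" by measurable
    show "0 \<le> ?w x" for x by simp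
    fix a :: "real ^ 'n" and l :: real assume l: "0 < l"
    let ?Q = "cbox a (a + (\<chi> i. l))"
    define r where "r = enn2real (rho (ennreal q) U ?Q e)"
    have r: "0 \<le> r" by (simp add: r_def)
    have Q: "?Q \<in> cubes" using l by (auto simp: cubes_def)
    show "emeasure (weighted ?w) (hcube a l) < \<infinity>" by (simp only: *[OF l]) simp
    obtain S where S: "S \<in> lmeasurable" "measure lebesgue S \<le> measure lebesgue ?Q / 2"
        "AE x in lebesgue. x \<in> ?Q \<longrightarrow> norm (U x e) \<le> b * r \<longrightarrow> x \<in> S"
      using nd[unfolded rho_nondegenerate_def, rule_format, OF Q e] unfolding r_def by blast
    let ?A = "{x \<in> hcube a l. ?w x * l ^ CARD('n) \<le> b powr q * measure (weighted ?w) (hcube a l)}"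
    have "emeasure lebesgue ?A \<le> emeasure lebesgue S"
    proof (rule emeasure_mono_AE)
      show "S \<in> sets lebesgue" using S(1) by auto
      show "AE x in lebesgue. x \<in> ?A \<longrightarrow> x \<in> S"
        using S(3)
      proof eventually_elim
        case (elim x)
        show ?case
        proof
          assume x: "x \<in> ?A"
          then have "norm (U x e) powr q \<le> (b * r) powr q"
            using l b r by (simp add: **[OF l] r_def[symmetric] powr_mult)
          then have "norm (U x e) \<le> b * r"
            using q b r powr_less_mono2[of q "b * r" "norm (U x e)"] by fastforce
          then show "x \<in> S" using elim x hcube_subset_cbox[of a l] by auto
        qed
      qed
    qed
    then have "emeasure lebesgue ?A \<le> ennreal (measure lebesgue S)"
      using S(1) by (simp only: emeasure_eq_measure2)
    note enn2real_leI[OF measure_nonneg this]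
    then have "measure lebesgue ?A \<le> measure lebesgue S"
      by (simp only: measure_def[of lebesgue ?A])
    also have "\<dots> \<le> l ^ CARD('n) / 2"
      using S(2) by (simp only: measure_cube[OF l])
    finally show "measure lebesgue ?A \<le> l ^ CARD('n) / 2" .
  qed
qed

text \<open>All scalar weights \<open>norm (U x e) powr q\<close> with \<open>e \<noteq> 0\<close>
  are spread with the same parameter, so one \<delta> and one constant serve every vector and every
  cube.\<close>

lemma rho_nondegenerate_reverse_Holder:
  fixes U :: "real ^ 'n \<Rightarrow> ('x::real_normed_vector \<Rightarrow>\<^sub>L 'x)"
  assumes q: "0 < q" and b: "0 < b" "b \<le> 1" and nd: "rho_nondegenerate b q U"
    and pw: "p_weight (ennreal q) U"
  obtains \<epsilon> C :: real where "0 < \<epsilon>" "0 \<le> C"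
    "\<And>Q e. Q \<in> cubes \<Longrightarrow> rho (ennreal (q + \<epsilon>)) U Q e \<le> ennreal C * rho (ennreal q) U Q e"
proof -
  have bq: "0 < b powr q" "b powr q \<le> 1"
    using b q powr_mono2[of q b 1] by auto
  obtain \<delta> C where d: "0 < \<delta>" and C: "0 \<le> C" and RH: "\<And>(w :: real ^ 'n \<Rightarrow> real) a l. spread (b powr q) w \<Longrightarrow> 0 < l \<Longrightarrow>
      (\<integral>\<^sup>+x\<in>hcube a l. ennreal (w x powr (1 + \<delta>)) \<partial>lebesgue) \<le>
      ennreal (C * (measure (weighted w) (hcube a l) / l ^ CARD('n)) powr (1 + \<delta>) * l ^ CARD('n))"
    by (rule spread_reverse_Holder[OF bq]) (rule that)
  define \<epsilon> where "\<epsilon> = q * \<delta>"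
  have eps: "0 < \<epsilon>" using q d by (simp add: \<epsilon>_def)
  have qe: "q + \<epsilon> = q * (1 + \<delta>)" by (simp add: \<epsilon>_def algebra_simps)
  \<comment> \<open>The root of \<open>C\<close> that reappears as \<open>C\<close> when the
    quasi-norm of exponent \<open>q + \<epsilon>\<close> is written as an integral.\<close>
  define D where "D = C powr (1 / (q + \<epsilon>))"
  have D: "0 \<le> D" "D powr (q + \<epsilon>) = C"
    using C q eps by (auto simp: D_def powr_powr)
  show thesis
  proof (rule that[OF eps D(1)])
    fix Q :: "(real ^ 'n) set" and e :: 'x assume Q: "Q \<in> cubes"
    then obtain a and l :: real where Qa: "Q = cbox a (a + (\<chi> i. l))" and l: "0 < l"
      by (auto simp: cubes_def)
    have qe0: "0 < q + \<epsilon>" using q eps by simp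
    define r where "r = enn2real (rho (ennreal q) U Q e)"
    have r0: "0 \<le> r" by (simp add: r_def)
    have r: "rho (ennreal q) U Q e = ennreal r"
      using p_weight_rho_lt_top[OF q pw Q, of e] by (simp add: r_def less_top)
    have lQ: "measure lebesgue Q = l ^ CARD('n)"
      unfolding Qa by (rule measure_cube[OF l])
    have "(\<integral>\<^sup>+x\<in>Q. ennreal (norm (U x e) powr (q + \<epsilon>)) \<partial>lebesgue) \<le>
        ennreal ((D * r) powr (q + \<epsilon>) * measure lebesgue Q)"
    proof (cases "e = 0")
      case True
      then show ?thesis using qe0 by simp
    next
      case False
      let ?w = "\<lambda>x. norm (U x e) powr q"
      have "(\<integral>\<^sup>+x\<in>Q. ennreal (norm (U x e) powr (q + \<epsilon>)) \<partial>lebesgue) =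
          (\<integral>\<^sup>+x\<in>hcube a l. ennreal (?w x powr (1 + \<delta>)) \<partial>lebesgue)"
        using AE_hcube_iff_cbox[of a l]
        by (intro nn_integral_cong_AE) (auto elim!: eventually_mono simp: indicator_def Qa powr_powr qe)
      also have "\<dots> \<le> ennreal (C * (measure (weighted ?w) (hcube a l) / l ^ CARD('n)) powr (1 + \<delta>) * l ^ CARD('n))"
        by (rule RH[OF rho_nondegenerate_spread(1)[OF q b(1) nd pw False] l])
      also have "C * (measure (weighted ?w) (hcube a l) / l ^ CARD('n)) powr (1 + \<delta>) * l ^ CARD('n) =
          (D * r) powr (q + \<epsilon>) * measure lebesgue Q"
      proof -
        have "measure (weighted ?w) (hcube a l) / l ^ CARD('n) = r powr q"
          using rho_nondegenerate_spread(2)[OF q b(1) nd pw False l, of a] l by (simp add: r_def Qa)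
        moreover have "C * (r powr q) powr (1 + \<delta>) * l ^ CARD('n) = (D * r) powr (q + \<epsilon>) * measure lebesgue Q"
          using D r0 by (simp add: powr_mult powr_powr lQ flip: qe)
        ultimately show ?thesis by (simp only:)
      qed
      finally show ?thesis .
    qed
    then have "rho (ennreal (q + \<epsilon>)) U Q e \<le> ennreal (D * r)"
      using D(1) r0 by (subst rho_le_iff[OF qe0 Q]) auto
    then show "rho (ennreal (q + \<epsilon>)) U Q e \<le> ennreal D * rho (ennreal q) U Q e"
      unfolding r using D(1) r0 by (simp add: ennreal_mult)
  qed
qed

text \<open>Inserting \<open>V y e\<close> for the vector in \<open>bd\<close> gives
  \<open>\<rho>(e) \<le> C \<parallel>V y e\<parallel>\<close> for almost every \<open>y\<close> in
  the cube, so the bad set is null and the empty set can serve as \<open>S\<close>.\<close>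

lemma A1_nondegenerate:
  fixes V :: "real ^ 'n \<Rightarrow> ('x::real_normed_vector \<Rightarrow>\<^sub>L 'x)"
  assumes q: "0 < q" and pw: "p_weight (ennreal q) V" and C: "1 \<le> C"
    and bd: "\<And>Q e. Q \<in> cubes \<Longrightarrow> esssup (restrict_space lebesgue Q)
      (\<lambda>y. rho (ennreal q) V Q (blinfun_inv (V y) e)) \<le> ennreal C * ennreal (norm e)"
  shows "rho_nondegenerate (1 / (2 * C)) q V"
proof (rule rho_nondegenerateI)
  fix Q :: "(real ^ 'n) set" and e :: 'x assume Q: "Q \<in> cubes" and e: "e \<noteq> 0"
  have meas: "strongly_measurable (\<lambda>x. V x f)" for f
    using pw by (auto simp: p_weight_def weight_def)
  have inv: "AE x in lebesgue. blinfun_invertible (V x)" and wV: "weight V"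
    using pw by (auto simp: p_weight_def weight_def)
  obtain s where s: "\<And>k::nat. simple_function lebesgue (s k)" "\<And>x. (\<lambda>k. s k x) \<longlonglongrightarrow> V x e"
    using meas[of e] by (auto simp: strongly_measurable_def)
  \<comment> \<open>The exceptional null set in the hypothesis depends on the vector, and \<open>V y e\<close> varies with \<open>y\<close>.
    Only the countably many values of approximating simple functions are used; lower semicontinuity
    does the rest.\<close>
  define D where "D = (\<Union>k. range (s k))"
  have "countable (range (s k))" for k
    using simple_functionD(1)[OF s(1), of k] by (simp add: countable_finite)
  then have D: "countable D" by (simp add: D_def)
  have "AE y in restrict_space lebesgue Q. rho (ennreal q) V Q (blinfun_inv (V y) d) \<le> ennreal (C * norm d)" for d
    using esssup_AE[of "\<lambda>y. rho (ennreal q) V Q (blinfun_inv (V y) d)" "restrict_space lebesgue Q"]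
  proof eventually_elim
    case (elim y)
    have "rho (ennreal q) V Q (blinfun_inv (V y) d) \<le> ennreal C * ennreal (norm d)"
      using elim bd[OF Q, of d] by (rule order_trans)
    then show ?case using C by (simp add: ennreal_mult)
  qed
  then have "AE y in lebesgue. y \<in> Q \<longrightarrow> rho (ennreal q) V Q (blinfun_inv (V y) d) \<le> ennreal (C * norm d)" for d
    using cubes_measure(3)[OF Q] by (subst (asm) AE_restrict_space_iff) auto
  then have "AE y in lebesgue. \<forall>d\<in>D. y \<in> Q \<longrightarrow> rho (ennreal q) V Q (blinfun_inv (V y) d) \<le> ennreal (C * norm d)"
    by (subst AE_ball_countable[OF D]) auto
  with inv have le: "AE y in lebesgue. y \<in> Q \<longrightarrow> enn2real (rho (ennreal q) V Q e) \<le> C * norm (V y e)"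
  proof eventually_elim
    case (elim y)
    show ?case
    proof (intro impI, rule field_le_epsilon)
      fix \<epsilon> :: real assume y: "y \<in> Q" and eps: "0 < \<epsilon>"
      have "(\<lambda>k. C * norm (s k y)) \<longlonglongrightarrow> C * norm (V y e)"
        using s(2)[of y] by (intro tendsto_intros)
      then have "eventually (\<lambda>k. C * norm (s k y) < C * norm (V y e) + \<epsilon>) sequentially"
        using eps by (intro order_tendstoD) auto
      \<comment> \<open>Dropping the first \<open>N\<close> approximants leaves a sequence with one
        uniform bound, as lower semicontinuity needs.\<close>
      then obtain N where N: "\<And>k. N \<le> k \<Longrightarrow> C * norm (s k y) < C * norm (V y e) + \<epsilon>"
        by (auto simp: eventually_sequentially)
      have "(\<lambda>k. s (k + N) y) \<longlonglongrightarrow> V y e"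
        using s(2)[of y] by (rule LIMSEQ_ignore_initial_segment)
      then have "(\<lambda>k. blinfun_inv (V y) (s (k + N) y)) \<longlonglongrightarrow> blinfun_inv (V y) (V y e)"
        by (intro blinfun.tendsto tendsto_const)
      then have lim: "(\<lambda>k. blinfun_inv (V y) (s (k + N) y)) \<longlonglongrightarrow> e"
        using elim(1) by (simp add: blinfun_inv_left)
      have "rho (ennreal q) V Q e \<le> ennreal (C * norm (V y e) + \<epsilon>)"
      proof (rule rho_lower_semicontinuous[OF q Q _ meas lim])
        show "0 \<le> C * norm (V y e) + \<epsilon>" using C eps by simp
        fix k
        have "rho (ennreal q) V Q (blinfun_inv (V y) (s (k + N) y)) \<le> ennreal (C * norm (s (k + N) y))"
          using elim(2) y by (auto simp: D_def)
        also have "\<dots> \<le> ennreal (C * norm (V y e) + \<epsilon>)"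
          using N[of "k + N"] by (intro ennreal_leI) simp
        finally show "rho (ennreal q) V Q (blinfun_inv (V y) (s (k + N) y)) \<le> ennreal (C * norm (V y e) + \<epsilon>)" .
      qed
      then show "enn2real (rho (ennreal q) V Q e) \<le> C * norm (V y e) + \<epsilon>"
        using C eps by (intro enn2real_leI) auto
    qed
  qed
  \<comment> \<open>Strict positivity contradicts \<open>\<rho>(e) \<le> \<rho>(e) / 2\<close>,
    which is what the factor 2 in \<open>1 / (2 * C)\<close> produces on the bad set.\<close>
  have r: "0 < enn2real (rho (ennreal q) V Q e)"
    using rho_pos[OF q wV Q e] p_weight_rho_lt_top[OF q pw Q, of e] by (simp add: enn2real_positive_iff)
  have "AE x in lebesgue. x \<in> Q \<longrightarrow> norm (V x e) \<le> 1 / (2 * C) * enn2real (rho (ennreal q) V Q e) \<longrightarrow> x \<in> {}"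
    using le
  proof eventually_elim
    case (elim x)
    show ?case
    proof (intro impI)
      assume x: "x \<in> Q" and "norm (V x e) \<le> 1 / (2 * C) * enn2real (rho (ennreal q) V Q e)"
      then have "C * norm (V x e) \<le> enn2real (rho (ennreal q) V Q e) / 2"
        using C by (simp add: field_simps)
      then show "x \<in> {}" using elim x r by simp
    qed
  qed
  then show "\<exists>S\<in>lmeasurable. measure lebesgue S \<le> measure lebesgue Q / 2 \<and>
      (AE x in lebesgue. x \<in> Q \<longrightarrow> norm (V x e) \<le> 1 / (2 * C) * enn2real (rho (ennreal q) V Q e) \<longrightarrow> x \<in> S)"
    by (intro bexI[of _ "{}"]) auto
qed

text \<open>Pairing \<open>inv_adjoint V x f\<close> with \<open>V x e\<close> gives back
  \<open>f e\<close>; if one factor is small, the other must be large.\<close>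

lemma abs_le_norm_inv_adjoint:
  assumes "blinfun_invertible (V x)"
  shows "\<bar>blinfun_apply f e\<bar> \<le> norm (inv_adjoint V x f) * norm (V x e)"
proof -
  have "f e = inv_adjoint V x f (V x e)"
    using assms by (simp add: inv_adjoint_def blinfun_adjoint_apply blinfun_inv_left)
  then show ?thesis using norm_blinfun[of "inv_adjoint V x f" "V x e"] by simp
qed

text \<open>A functional \<open>f\<close> with \<open>f e = r e\<close> and dual norm at most 1 has
  dual-weight quasi-norm at most \<open>C\<close>. Where \<open>norm (V x e)\<close> is at most
  \<open>r e / (2 * C)\<close>, the pairing forces \<open>norm (inv_adjoint V x f)\<close> to be at
  least \<open>2 * C\<close>, and Chebyshev's inequality bounds that set.\<close>

lemma Ap_nondegenerate:
  fixes V :: "real ^ 'n \<Rightarrow> ('x::banach \<Rightarrow>\<^sub>L 'x)"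
  assumes q: "1 \<le> q" and q': "1 \<le> q'" and pw: "p_weight (ennreal q) V"
    and pw': "p_weight (ennreal q') (inv_adjoint V)" and C: "1 \<le> C"
    and bd: "\<And>Q f. Q \<in> cubes \<Longrightarrow> rho (ennreal q') (inv_adjoint V) Q f \<le>
      ennreal C * dual_norm (rho (ennreal q) V Q) f"
  shows "rho_nondegenerate (1 / (2 * C)) q V"
proof (rule rho_nondegenerateI)
  fix Q :: "(real ^ 'n) set" and e :: 'x assume Q: "Q \<in> cubes" and e: "e \<noteq> 0"
  have q0: "0 < q" using q by simp
  have meas: "strongly_measurable (\<lambda>x. V x d)" for d
    using pw by (auto simp: p_weight_def weight_def)
  have meas': "strongly_measurable (\<lambda>x. inv_adjoint V x f)" for f
    using pw' by (auto simp: p_weight_def weight_def)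
  have inv: "AE x in lebesgue. blinfun_invertible (V x)" and wV: "weight V"
    using pw pw' by (auto simp: p_weight_def weight_def)
  have fin: "rho (ennreal q) V Q d < \<infinity>" for d
    by (rule p_weight_rho_lt_top[OF q0 pw Q])
  define r where "r d = enn2real (rho (ennreal q) V Q d)" for d
  have r: "rho (ennreal q) V Q d = ennreal (r d)" for d
    using fin[of d] by (simp add: r_def less_top)
  have rpos: "0 < r d" if "d \<noteq> 0" for d
    using rho_pos[OF q0 wV Q that] by (simp add: r)
  have tri: "r (x + y) \<le> r x + r y" for x y
    unfolding r_def by (rule rho_triangle[OF q Q meas fin])
  have hom: "r (c *\<^sub>R x) = \<bar>c\<bar> * r x" for c x
    unfolding r_def by (rule rho_scale[OF q0 Q meas fin])
  \<comment> \<open>Together with completeness this bounds \<open>r\<close> by a multiple of the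
    norm, so that the Hahn--Banach functional belongs to the dual space.\<close>
  have "closed {x. r x \<le> c}" if c: "0 \<le> c" for c
    unfolding closed_sequential_limits
  proof (intro allI impI, elim conjE)
    fix d l assume d: "\<forall>k::nat. d k \<in> {x. r x \<le> c}" and lim: "d \<longlonglongrightarrow> l"
    have "rho (ennreal q) V Q l \<le> ennreal c"
      by (rule rho_lower_semicontinuous[OF q0 Q c meas lim]) (use d in \<open>auto simp: r intro: ennreal_leI\<close>)
    then show "l \<in> {x. r x \<le> c}" using c by (simp add: r)
  qed
  then obtain K where K: "\<And>x. r x \<le> K * norm x"
    using seminorm_bounded_of_closed_balls[OF tri hom] by metis
  obtain g where g: "linear g" "g e = r e" "\<And>x. \<bar>g x\<bar> \<le> r x"
    using hahn_banach_seminorm[where \<rho> = r, OF tri hom] by metis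
  have "bounded_linear g"
    using g K by (intro bounded_linear_intro[of g K] linear_add linear_scale)
      (auto intro: order_trans simp: mult.commute)
  define f where "f = Blinfun g"
  have f: "blinfun_apply f = g"
    using \<open>bounded_linear g\<close> by (simp add: f_def bounded_linear_Blinfun_apply)
  have "dual_norm (rho (ennreal q) V Q) f \<le> 1"
    unfolding dual_norm_def
  proof (rule SUP_least)
    fix d :: 'x assume "d \<in> UNIV - {0}"
    then show "ennreal \<bar>f d\<bar> / rho (ennreal q) V Q d \<le> 1"
      using g(3)[of d] rpos[of d] by (simp add: r f divide_ennreal)
  qed
  then have "rho (ennreal q') (inv_adjoint V) Q f \<le> ennreal C"
    using bd[OF Q, of f] by (metis mult.right_neutral mult_left_mono order_trans zero_le)
  then have le: "rho (ennreal q') (inv_adjoint V) Q f \<le> ennreal (2 * C / 2)" by simp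
  have C2: "0 < 2 * C" using C by simp
  note S = rho_chebyshev[OF q' Q meas' C2 le]
  have "AE x in lebesgue. x \<in> Q \<longrightarrow> norm (V x e) \<le> 1 / (2 * C) * r e \<longrightarrow>
      x \<in> {x \<in> Q. 2 * C \<le> norm (inv_adjoint V x f)}"
    using inv
  proof eventually_elim
    case (elim x)
    have "r e \<le> norm (inv_adjoint V x f) * norm (V x e)"
      using abs_le_norm_inv_adjoint[of V x f e, OF elim] by (simp add: f g)
    moreover have "norm (inv_adjoint V x f) * norm (V x e) \<le> norm (inv_adjoint V x f) * (1 / (2 * C) * r e)"
      if "norm (V x e) \<le> 1 / (2 * C) * r e"
      using that by (intro mult_left_mono) auto
    ultimately have "norm (V x e) \<le> 1 / (2 * C) * r e \<Longrightarrow>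
        1 * r e \<le> (norm (inv_adjoint V x f) / (2 * C)) * r e"
      by (simp add: mult_ac)
    then have "norm (V x e) \<le> 1 / (2 * C) * r e \<Longrightarrow> 1 \<le> norm (inv_adjoint V x f) / (2 * C)"
      using rpos[OF e] by (meson mult_le_cancel_right_pos)
    then show ?case using C2 by (simp add: le_divide_eq)
  qed
  then show "\<exists>S\<in>lmeasurable. measure lebesgue S \<le> measure lebesgue Q / 2 \<and>
      (AE x in lebesgue. x \<in> Q \<longrightarrow> norm (V x e) \<le> 1 / (2 * C) * enn2real (rho (ennreal q) V Q e) \<longrightarrow> x \<in> S)"
    using S unfolding r_def by blast
qed

text \<open>The dual norm is a supremum, so some \<open>d\<close> nearly attains what the hypothesis
  guarantees. Where \<open>inv_adjoint V x f\<close> is small, the pairing with \<open>V x d\<close>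
  forces \<open>norm (V x d)\<close> above twice \<open>r d\<close>, and Chebyshev's inequality
  applies to \<open>V\<close>.\<close>

lemma Ap_inv_adjoint_nondegenerate:
  fixes V :: "real ^ 'n \<Rightarrow> ('x::real_normed_vector \<Rightarrow>\<^sub>L 'x)"
  assumes q: "1 \<le> q" and q': "1 \<le> q'" and pw: "p_weight (ennreal q) V"
    and pw': "p_weight (ennreal q') (inv_adjoint V)" and C: "1 \<le> C"
    and bd: "\<And>Q f. Q \<in> cubes \<Longrightarrow> rho (ennreal q') (inv_adjoint V) Q f \<le>
      ennreal C * dual_norm (rho (ennreal q) V Q) f"
  shows "rho_nondegenerate (1 / (4 * C)) q' (inv_adjoint V)"
proof (rule rho_nondegenerateI)
  fix Q :: "(real ^ 'n) set" and f :: "'x dual" assume Q: "Q \<in> cubes" and f: "f \<noteq> 0"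
  have q0: "0 < q" "0 < q'" using q q' by auto
  have meas: "strongly_measurable (\<lambda>x. V x d)" for d
    using pw by (auto simp: p_weight_def weight_def)
  have inv: "AE x in lebesgue. blinfun_invertible (V x)" and wV: "weight V"
    and wV': "weight (inv_adjoint V)"
    using pw pw' by (auto simp: p_weight_def weight_def)
  define R where "R = enn2real (rho (ennreal q') (inv_adjoint V) Q f)"
  have R: "rho (ennreal q') (inv_adjoint V) Q f = ennreal R"
    using p_weight_rho_lt_top[OF q0(2) pw' Q, of f] by (simp add: R_def less_top)
  have Rpos: "0 < R" using rho_pos[OF q0(2) wV' Q f] by (simp add: R)
  define r where "r d = enn2real (rho (ennreal q) V Q d)" for d
  have r: "rho (ennreal q) V Q d = ennreal (r d)" for d
    using p_weight_rho_lt_top[OF q0(1) pw Q, of d] by (simp add: r_def less_top)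
  have rpos: "0 < r d" if "d \<noteq> 0" for d
    using rho_pos[OF q0(1) wV Q that] by (simp add: r)
  \<comment> \<open>The hypothesis bounds the dual norm below by \<open>R / C\<close>; giving away a
    factor 2 makes the inequality strict, so a vector can be picked from the supremum. The threshold
    2 in Chebyshev's inequality doubles this to \<open>4 * C\<close>.\<close>
  have "ennreal (R / (2 * C)) < dual_norm (rho (ennreal q) V Q) f"
  proof (rule ccontr)
    assume "\<not> ?thesis"
    then have "ennreal R \<le> ennreal C * ennreal (R / (2 * C))"
      using bd[OF Q, of f] unfolding R by (meson mult_left_mono not_le order_trans zero_le)
    also have "\<dots> = ennreal (R / 2)" using C Rpos by (simp flip: ennreal_mult)
    finally show False using Rpos by simp
  qed
  then obtain d where d: "d \<noteq> 0" "ennreal (R / (2 * C)) < ennreal \<bar>f d\<bar> / rho (ennreal q) V Q d"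
    unfolding dual_norm_def less_SUP_iff by auto
  then have fd: "R / (2 * C) < \<bar>f d\<bar> / r d"
    using rpos[OF d(1)] Rpos C by (simp add: r divide_ennreal ennreal_less_iff)
  let ?s = "2 * r d"
  have s: "0 < ?s" using rpos[OF d(1)] by simp
  have le: "rho (ennreal q) V Q d \<le> ennreal (?s / 2)" by (simp add: r)
  note S = rho_chebyshev[OF q Q meas s le]
  have "AE x in lebesgue. x \<in> Q \<longrightarrow> norm (inv_adjoint V x f) \<le> 1 / (4 * C) * R \<longrightarrow>
      x \<in> {x \<in> Q. ?s \<le> norm (V x d)}"
    using inv
  proof eventually_elim
    case (elim x)
    have "?s \<le> norm (V x d)" if "norm (inv_adjoint V x f) \<le> 1 / (4 * C) * R"
    proof -
      have "\<bar>f d\<bar> \<le> 1 / (4 * C) * R * norm (V x d)"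
        using abs_le_norm_inv_adjoint[of V x f d, OF elim] that
        by (meson mult_right_mono norm_ge_zero order_trans)
      moreover have "R * r d < 2 * C * \<bar>f d\<bar>"
        using fd rpos[OF d(1)] C by (simp add: field_simps)
      ultimately have "R * r d < 2 * C * (1 / (4 * C) * R * norm (V x d))"
        using C by (smt (verit) mult_left_mono)
      then have "R * (2 * r d) < R * norm (V x d)" using C by (simp add: field_simps)
      then show ?thesis using Rpos by simp
    qed
    then show ?case by simp
  qed
  then show "\<exists>S\<in>lmeasurable. measure lebesgue S \<le> measure lebesgue Q / 2 \<and>
      (AE x in lebesgue. x \<in> Q \<longrightarrow> norm (inv_adjoint V x f) \<le>
         1 / (4 * C) * enn2real (rho (ennreal q') (inv_adjoint V) Q f) \<longrightarrow> x \<in> S)"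
    using S unfolding R_def by blast
qed

theorem proposition5p1:
  fixes V :: "real ^ 'n \<Rightarrow> ('x::banach \<Rightarrow>\<^sub>L 'x)" and p :: real
  assumes "0 < p"
    and "Ap_weight p V"
  shows "\<exists>\<epsilon> \<eta> C :: real. \<epsilon> > 0 \<and> \<eta> > 0 \<and>
    (\<forall>Q\<in>cubes. \<forall>(e::'x) (f::'x dual).
       rho (ennreal (p + \<epsilon>)) V Q e \<le> ennreal C * rho (ennreal p) V Q e \<and>
       rho (conj_exponent p + ennreal \<eta>) (inv_adjoint V) Q f
         \<le> ennreal C * rho (conj_exponent p) (inv_adjoint V) Q f)"
proof -
  have pw: "p_weight (ennreal p) V" using assms(2) by (simp add: Ap_weight_def)
  show ?thesis
  proof (cases "p > 1")
    case False
    then obtain C0 where C0: "\<And>Q e. Q \<in> cubes \<Longrightarrow> esssup (restrict_space lebesgue Q)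
        (\<lambda>y. rho (ennreal p) V Q (blinfun_inv (V y) e)) \<le> ennreal C0 * ennreal (norm e)"
      using assms(2) by (auto simp: Ap_weight_def)
    \<comment> \<open>Enlarging the constant to at least 1 keeps \<open>1 / (2 * C)\<close> at most
      1, as required of the nondegeneracy parameter.\<close>
    define C where "C = max 1 C0"
    have C: "1 \<le> C" by (simp add: C_def)
    have "esssup (restrict_space lebesgue Q)
        (\<lambda>y. rho (ennreal p) V Q (blinfun_inv (V y) e)) \<le> ennreal C * ennreal (norm e)"
      if "Q \<in> cubes" for Q e
      using C0[OF that, of e] by (rule order_trans) (auto simp: C_def intro!: mult_right_mono ennreal_leI)
    then have "rho_nondegenerate (1 / (2 * C)) p V"
      by (rule A1_nondegenerate[OF assms(1) pw C])
    moreover have b: "0 < 1 / (2 * C)" "1 / (2 * C) \<le> 1" using C by auto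
    ultimately obtain \<epsilon> D where eps: "0 < \<epsilon>" "0 \<le> D"
      and RH: "\<And>Q e. Q \<in> cubes \<Longrightarrow> rho (ennreal (p + \<epsilon>)) V Q e \<le> ennreal D * rho (ennreal p) V Q e"
      using rho_nondegenerate_reverse_Holder[OF assms(1) b _ pw] by metis
    have top: "conj_exponent p = \<infinity>" using False by (simp add: conj_exponent_def)
    show ?thesis
    proof (intro exI conjI ballI allI)
      \<comment> \<open>The conjugate exponent is infinite, so adding any \<eta> leaves it
        unchanged; 1 is an arbitrary choice, and a constant of at least 1 settles the second
        inequality.\<close>
      show "\<epsilon> > 0" "(1::real) > 0" using eps by auto
      fix Q :: "(real ^ 'n) set" and e :: 'x and f :: "'x dual" assume Q: "Q \<in> cubes"
      show "rho (ennreal (p + \<epsilon>)) V Q e \<le> ennreal (max 1 D) * rho (ennreal p) V Q e"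
        using RH[OF Q, of e] by (rule order_trans) (auto intro!: mult_right_mono ennreal_leI)
      have "1 * rho \<infinity> (inv_adjoint V) Q f \<le> ennreal (max 1 D) * rho \<infinity> (inv_adjoint V) Q f"
        by (intro mult_right_mono) (auto simp flip: ennreal_1 intro!: ennreal_leI simp del: ennreal_1)
      then show "rho (conj_exponent p + ennreal 1) (inv_adjoint V) Q f \<le>
          ennreal (max 1 D) * rho (conj_exponent p) (inv_adjoint V) Q f"
        by (simp add: top)
    qed
  next
    case True
    define p' where "p' = p / (p - 1)"
    \<comment> \<open>Both exponents are at least 1, as the two nondegeneracy arguments
      require.\<close>
    have p': "1 \<le> p'" "0 < p'" and p1: "1 \<le> p" using True by (auto simp: p'_def)
    have conj: "conj_exponent p = ennreal p'" using True by (simp add: conj_exponent_def p'_def)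
    have pw': "p_weight (ennreal p') (inv_adjoint V)"
      using assms(2) True by (simp add: Ap_weight_def conj)
    obtain C0 where C0: "\<And>Q f. Q \<in> cubes \<Longrightarrow> rho (ennreal p') (inv_adjoint V) Q f \<le>
        ennreal C0 * dual_norm (rho (ennreal p) V Q) f"
      using assms(2) True by (auto simp: Ap_weight_def conj)
    define C where "C = max 1 C0"
    have C: "1 \<le> C" by (simp add: C_def)
    have bd: "rho (ennreal p') (inv_adjoint V) Q f \<le> ennreal C * dual_norm (rho (ennreal p) V Q) f"
      if "Q \<in> cubes" for Q f
      using C0[OF that, of f] by (rule order_trans) (auto simp: C_def intro!: mult_right_mono ennreal_leI)
    have b: "0 < 1 / (2 * C)" "1 / (2 * C) \<le> 1" "0 < 1 / (4 * C)" "1 / (4 * C) \<le> 1"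
      using C by auto
    obtain \<epsilon> D where eps: "0 < \<epsilon>" "0 \<le> D"
      and RH: "\<And>Q e. Q \<in> cubes \<Longrightarrow> rho (ennreal (p + \<epsilon>)) V Q e \<le> ennreal D * rho (ennreal p) V Q e"
      using rho_nondegenerate_reverse_Holder[OF assms(1) b(1,2) Ap_nondegenerate[OF p1 p'(1) pw pw' C bd] pw]
      by metis
    obtain \<eta> E where eta: "0 < \<eta>" "0 \<le> E"
      and RH': "\<And>Q f. Q \<in> cubes \<Longrightarrow> rho (ennreal (p' + \<eta>)) (inv_adjoint V) Q f \<le>
        ennreal E * rho (ennreal p') (inv_adjoint V) Q f"
      using rho_nondegenerate_reverse_Holder[OF p'(2) b(3,4) Ap_inv_adjoint_nondegenerate[OF p1 p'(1) pw pw' C bd] pw']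
      by metis
    show ?thesis
    proof (intro exI conjI ballI allI)
      show "\<epsilon> > 0" "\<eta> > 0" using eps eta by auto
      fix Q :: "(real ^ 'n) set" and e :: 'x and f :: "'x dual" assume Q: "Q \<in> cubes"
      \<comment> \<open>The two reverse Hoelder inequalities come with separate constants; their
        maximum serves both.\<close>
      show "rho (ennreal (p + \<epsilon>)) V Q e \<le> ennreal (max D E) * rho (ennreal p) V Q e"
        using RH[OF Q, of e] by (rule order_trans) (auto intro!: mult_right_mono ennreal_leI)
      have "rho (ennreal (p' + \<eta>)) (inv_adjoint V) Q f \<le> ennreal (max D E) * rho (ennreal p') (inv_adjoint V) Q f"
        using RH'[OF Q, of f] by (rule order_trans) (auto intro!: mult_right_mono ennreal_leI)
      then show "rho (conj_exponent p + ennreal \<eta>) (inv_adjoint V) Q f \<le>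
          ennreal (max D E) * rho (conj_exponent p) (inv_adjoint V) Q f"
        using p' eta by (simp add: conj)
    qed
  qed
qed

end
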